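(* Suppose a graph of groups is given, with underlying connected graph $\Delta$ (without self-reverse arcs), vertex groups $G(v)$, arc groups $H(a)=H(\bar a)$ and injective homomorphisms $\theta_a\colon H(a)\to G(t(a))$. Construct a graph of group actions $\mathcal G$ with base graph $\Delta$ as follows: the action at a vertex $v$ is the (left) regular action of $G(v)$ on itself, the action at an arc $a$ is the (left) regular action of $H(a)$ on itself, and the embedding of $(H(a),H(a))$ into $(G(t(a)),G(t(a)))$ is given by $\theta_a$. Then the action of the fundamental group of the graph of groups on its associated (Bass–Serre) tree is isomorphic to the action of the universal group of $\mathcal G$ on its associated tree. In particular, the fundamental group of the graph of groups is isomorphic to the universal group of $\mathcal G$.
   Context: **Graphs.** A graph $\Gamma$ has a vertex set $V\Gamma$, an arc set $A\Gamma$, maps $o,t\colon A\Gamma\to V\Gamma$ (origin, terminus) and an involution $a\mapsto\bar a$ on arcs with $o(a)=t(\bar a)$; an arc with $\bar a=a$ is called self-reverse. Graph morphisms preserve $o$, $t$ and reversal. A tree is a connected graph without loops and without two arcs having the same origin and the same terminus, which has no simple cycles of length $\ge 3$. Graphs of groups, their fundamental groups and Bass–Serre trees are as in Serre's book "Trees". Two actions $(G,T)$, $(G',T')$ on trees are isomorphic if there are a group isomorphism $\varphi\colon G\to G'$ and a tree isomorphism $\Phi\colon T\to T'$ with $\varphi(g)\Phi=\Phi g$ for all $g\in G$. **Group actions.** A permutation group action $(G,X)$ is a faithful action of a group $G$ on a non-empty set $X$. For $Y\subseteq X$, $G^Y$ is the permutation group induced on $Y$ by the setwise stabiliser of $Y$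 in $G$. An embedding $(H,Y)\hookrightarrow(G,X)$ of permutation group actions is given by an injection $\Phi\colon Y\to X$ such that $h\mapsto \Phi h\Phi^{-1}$ is an isomorphism from $H$ onto $G^{\Phi(Y)}$. **Graph of group actions without self-reverse arcs.** Such a $\mathcal G$ consists of: a connected graph $\Delta$ without self-reverse arcs (base graph); for every $v\in V\Delta$ a permutation group action $(G(v),X(v))$; for every $a\in A\Delta$ a permutation group action $(H(a),Y(a))$ with $(H(\bar a),Y(\bar a))=(H(a),Y(a))$ and an embedding $\Phi_a\colon(H(a),Y(a))\hookrightarrow(G(t(a)),X(t(a)))$. An $a$-adhesion map is a map $g\Phi_a\colon Y(a)\to X(t(a))$ with $g\in G(t(a))$; its image is called an $a$-adhesion set. **Scaffolding.** A scaffolding $(\Sigma,\sim,\pi,p)$ for $\mathcal G$ is a graph $\Sigma$ with an equivalence relation $\sim$ on $V\Sigma$, extended to $A\Sigma$ by $a\sim a'$ iff $o(a)\sim o(a')$ and $t(a)\sim t(a')$ (write $[x]$ for the class of $x$ as a set and $\llbracket x\rrbracket$ for the class as a vertex or arc of $T_\Sigma:=\Sigma/\!\sim$), such that: (i) $T_\Sigma$ is a tree; (ii) no arc of $\Sigma$ has both ends in the same class; (iii) $\pi\colon T_\Sigma\to\Delta$ is a graph morphism; (iv) $p$ (a legal colouring) is a map from $V\Sigma\cup A\Sigma$ to $\bigcup_v X(v)\cup\bigcup_a Y(a)$ such that: $p$ restricts to bijections $[v]\to X(\pi(\llbracket v\rrbracket))$ and $[a]\to Y(\pi(\llbracket a\rrbracket))$;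 $p(\bar b)=p(b)$ for every arc $b$; the unique map $\Psi_{\llbracket a\rrbracket}\colon Y(\pi(\llbracket a\rrbracket))\to X(\pi(t(\llbracket a\rrbracket)))$ with $\Psi_{\llbracket a\rrbracket}(p(b))=p(t(b))$ for all $b\in[a]$ is a $\pi(\llbracket a\rrbracket)$-adhesion map; and for every vertex $\llbracket v\rrbracket$ of $T_\Sigma$, every $b\in A\Delta$ with $t(b)=\pi(\llbracket v\rrbracket)$ and every $b$-adhesion set $S$, there is exactly one arc $\llbracket a\rrbracket$ of $T_\Sigma$ with $t(\llbracket a\rrbracket)=\llbracket v\rrbracket$, $\pi(\llbracket a\rrbracket)=b$ and $\Psi_{\llbracket a\rrbracket}(Y(b))=S$. **Universal group.** Fix a scaffolding $(\Sigma,\sim,\pi,p)$ for $\mathcal G$. The universal group $\mathcal U(\mathcal G)$ is the group of all graph automorphisms $g$ of $\Sigma$ which preserve $\sim$, satisfy $\pi(\llbracket g(x)\rrbracket)=\pi(\llbracket x\rrbracket)$ for all vertices and arcs $x$, and are acceptable: for every $\llbracket v\rrbracket\in VT_\Sigma$ the permutation $g_{\llbracket v\rrbracket}$ of $X(\pi(\llbracket v\rrbracket))$ determined by $g_{\llbracket v\rrbracket}(p(x))=p(g(x))$, $x\in[v]$, lies in $G(\pi(\llbracket v\rrbracket))$. The associated tree of $\mathcal G$ is $T_{\mathcal G}=T_\Sigma$, on which $\mathcal U(\mathcal G)$ acts naturally. *)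

theory Defs
  imports
    "Graph_Theory.Digraph_Component"
    "HOL-Algebra.Group_Action"
begin

section \<open>Graphs with arc reversal\<close>

text \<open>
  The origin and the terminus of an arc are its \<^const>\<open>tail\<close> and its \<^const>\<open>head\<close>. An arc is
  allowed to be its own reverse, so \<open>bidirected_digraph\<close> is too restrictive here.
\<close>

record ('v, 'a) pre_rgraph = "('v, 'a) pre_digraph" +
  arev :: "'a \<Rightarrow> 'a"

abbreviation dg :: "('v, 'a) pre_rgraph \<Rightarrow> ('v, 'a) pre_digraph" where
  "dg \<Gamma> \<equiv> pre_digraph.truncate \<Gamma>"

locale rgraph = wf_digraph "dg \<Gamma>" for \<Gamma> :: "('v, 'a) pre_rgraph" +
  assumes arev_in_arcs: "a \<in> arcs \<Gamma> \<Longrightarrow> arev \<Gamma> a \<in> arcs \<Gamma>"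
    and arev_arev: "a \<in> arcs \<Gamma> \<Longrightarrow> arev \<Gamma> (arev \<Gamma> a) = a"
    and tail_arev: "a \<in> arcs \<Gamma> \<Longrightarrow> tail \<Gamma> (arev \<Gamma> a) = head \<Gamma> a"

text \<open>Since arcs are reversible, strong connectedness of the digraph is plain connectedness.\<close>

locale connected_rgraph = rgraph +
  assumes connected: "strongly_connected (dg \<Gamma>)"

locale rtree = connected_rgraph + loopfree_digraph "dg \<Gamma>" + nomulti_digraph "dg \<Gamma>" +
  assumes no_long_cycle: "pre_digraph.cycle (dg \<Gamma>) p \<Longrightarrow> length p < 3"

definition rgraph_hom ::
  "('v, 'a) pre_rgraph \<Rightarrow> ('w, 'b) pre_rgraph \<Rightarrow> ('v \<Rightarrow> 'w) \<Rightarrow> ('a \<Rightarrow> 'b) \<Rightarrow> bool" where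
  "rgraph_hom \<Gamma> \<Gamma>' f f' \<longleftrightarrow>
     f \<in> verts \<Gamma> \<rightarrow> verts \<Gamma>' \<and> f' \<in> arcs \<Gamma> \<rightarrow> arcs \<Gamma>' \<and>
     (\<forall>a\<in>arcs \<Gamma>. tail \<Gamma>' (f' a) = f (tail \<Gamma> a) \<and> head \<Gamma>' (f' a) = f (head \<Gamma> a) \<and>
                 arev \<Gamma>' (f' a) = f' (arev \<Gamma> a))"

definition rgraph_iso ::
  "('v, 'a) pre_rgraph \<Rightarrow> ('w, 'b) pre_rgraph \<Rightarrow> ('v \<Rightarrow> 'w) \<Rightarrow> ('a \<Rightarrow> 'b) \<Rightarrow> bool" where
  "rgraph_iso \<Gamma> \<Gamma>' f f' \<longleftrightarrow> rgraph_hom \<Gamma> \<Gamma>' f f' \<and>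
     bij_betw f (verts \<Gamma>) (verts \<Gamma>') \<and> bij_betw f' (arcs \<Gamma>) (arcs \<Gamma>')"

definition spanning_tree_arcs :: "('v, 'a) pre_rgraph \<Rightarrow> 'a set \<Rightarrow> bool" where
  "spanning_tree_arcs \<Gamma> E \<longleftrightarrow> E \<subseteq> arcs \<Gamma> \<and> rtree (\<Gamma>\<lparr>arcs := E\<rparr>)"

definition orientation :: "('v, 'a) pre_rgraph \<Rightarrow> 'a set \<Rightarrow> bool" where
  "orientation \<Gamma> A \<longleftrightarrow> A \<union> arev \<Gamma> ` A = arcs \<Gamma> \<and> A \<inter> arev \<Gamma> ` A = {}"


section \<open>Groups acting on graphs\<close>

record ('k, 'v, 'a) graph_action =
  agroup :: "'k monoid"
  agraph :: "('v, 'a) pre_rgraph"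
  on_verts :: "'k \<Rightarrow> 'v \<Rightarrow> 'v"
  on_arcs :: "'k \<Rightarrow> 'a \<Rightarrow> 'a"

definition isomorphic_actions ::
  "('k, 'v, 'a) graph_action \<Rightarrow> ('l, 'w, 'b) graph_action \<Rightarrow> bool" where
  "isomorphic_actions P Q \<longleftrightarrow>
     (\<exists>\<phi> f f'. \<phi> \<in> iso (agroup P) (agroup Q) \<and> rgraph_iso (agraph P) (agraph Q) f f' \<and>
        (\<forall>k\<in>carrier (agroup P).
           (\<forall>x\<in>verts (agraph P). on_verts Q (\<phi> k) (f x) = f (on_verts P k x)) \<and>
           (\<forall>a\<in>arcs (agraph P). on_arcs Q (\<phi> k) (f' a) = f' (on_arcs P k a))))"


section \<open>Permutation group actions\<close>

definition perm_action :: "'k monoid \<Rightarrow> 'x set \<Rightarrow> ('k \<Rightarrow> 'x \<Rightarrow> 'x) \<Rightarrow> bool" where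
  "perm_action G X \<alpha> \<longleftrightarrow> X \<noteq> {} \<and> faithful_action G X \<alpha>"

definition induced_group :: "'k monoid \<Rightarrow> ('k \<Rightarrow> 'x \<Rightarrow> 'x) \<Rightarrow> 'x set \<Rightarrow> ('x \<Rightarrow> 'x) monoid" where
  "induced_group G \<alpha> Y =
     (BijGroup Y)\<lparr>carrier := (\<lambda>g. restrict (\<alpha> g) Y) ` {g \<in> carrier G. \<alpha> g ` Y = Y}\<rparr>"

definition perm_embedding ::
  "'h monoid \<Rightarrow> 'y set \<Rightarrow> ('h \<Rightarrow> 'y \<Rightarrow> 'y) \<Rightarrow> 'k monoid \<Rightarrow> 'x set \<Rightarrow> ('k \<Rightarrow> 'x \<Rightarrow> 'x) \<Rightarrow> ('y \<Rightarrow> 'x) \<Rightarrow> bool"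
  where
  "perm_embedding H Y \<beta> G X \<alpha> \<Phi> \<longleftrightarrow>
     \<Phi> \<in> Y \<rightarrow> X \<and> inj_on \<Phi> Y \<and>
     (\<lambda>h. \<lambda>z\<in>\<Phi> ` Y. \<Phi> (\<beta> h (inv_into Y \<Phi> z))) \<in> iso H (induced_group G \<alpha> (\<Phi> ` Y))"

definition left_regular :: "'k monoid \<Rightarrow> 'k \<Rightarrow> 'k \<Rightarrow> 'k" where
  "left_regular G g = (\<lambda>x\<in>carrier G. g \<otimes>\<^bsub>G\<^esub> x)"


section \<open>Graphs of groups and graphs of group actions\<close>

record ('v, 'a, 'g, 'h) group_family =
  base :: "('v, 'a) pre_rgraph"
  vgrp :: "'v \<Rightarrow> 'g monoid"
  agrp :: "'a \<Rightarrow> 'h monoid"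

locale group_family =
  fixes \<G> :: "('v, 'a, 'g, 'h, 'z) group_family_scheme" (structure)
  assumes connected_base: "connected_rgraph (base \<G>)"
    and no_self_reverse: "a \<in> arcs (base \<G>) \<Longrightarrow> arev (base \<G>) a \<noteq> a"
    and group_vgrp: "v \<in> verts (base \<G>) \<Longrightarrow> group (vgrp \<G> v)"
    and group_agrp: "a \<in> arcs (base \<G>) \<Longrightarrow> group (agrp \<G> a)"
    and agrp_arev: "a \<in> arcs (base \<G>) \<Longrightarrow> agrp \<G> (arev (base \<G>) a) = agrp \<G> a"

record ('v, 'a, 'g, 'h) gog = "('v, 'a, 'g, 'h) group_family" +
  incl :: "'a \<Rightarrow> 'h \<Rightarrow> 'g"

locale graph_of_groups = group_family \<G> for \<G> :: "('v, 'a, 'g, 'h) gog" (structure) +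
  assumes incl_mon:
    "a \<in> arcs (base \<G>) \<Longrightarrow> incl \<G> a \<in> mon (agrp \<G> a) (vgrp \<G> (head (base \<G>) a))"

record ('v, 'a, 'g, 'h, 'x, 'y) goga = "('v, 'a, 'g, 'h) group_family" +
  vset :: "'v \<Rightarrow> 'x set"
  vact :: "'v \<Rightarrow> 'g \<Rightarrow> 'x \<Rightarrow> 'x"
  aset :: "'a \<Rightarrow> 'y set"
  aact :: "'a \<Rightarrow> 'h \<Rightarrow> 'y \<Rightarrow> 'y"
  emb :: "'a \<Rightarrow> 'y \<Rightarrow> 'x"

locale graph_of_group_actions = group_family \<G>
  for \<G> :: "('v, 'a, 'g, 'h, 'x, 'y) goga" (structure) +
  assumes vact: "v \<in> verts (base \<G>) \<Longrightarrow> perm_action (vgrp \<G> v) (vset \<G> v) (vact \<G> v)"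
    and aact: "a \<in> arcs (base \<G>) \<Longrightarrow> perm_action (agrp \<G> a) (aset \<G> a) (aact \<G> a)"
    and aset_arev: "a \<in> arcs (base \<G>) \<Longrightarrow> aset \<G> (arev (base \<G>) a) = aset \<G> a"
    and aact_arev: "a \<in> arcs (base \<G>) \<Longrightarrow> aact \<G> (arev (base \<G>) a) = aact \<G> a"
    and emb: "a \<in> arcs (base \<G>) \<Longrightarrow>
      perm_embedding (agrp \<G> a) (aset \<G> a) (aact \<G> a)
        (vgrp \<G> (head (base \<G>) a)) (vset \<G> (head (base \<G>) a)) (vact \<G> (head (base \<G>) a))
        (emb \<G> a)"

definition adhesion_map :: "('v, 'a, 'g, 'h, 'x, 'y) goga \<Rightarrow> 'a \<Rightarrow> ('y \<Rightarrow> 'x) \<Rightarrow> bool" where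
  "adhesion_map \<G> a \<Psi> \<longleftrightarrow>
     (\<exists>g\<in>carrier (vgrp \<G> (head (base \<G>) a)).
        \<forall>y\<in>aset \<G> a. \<Psi> y = vact \<G> (head (base \<G>) a) g (emb \<G> a y))"

definition adhesion_set :: "('v, 'a, 'g, 'h, 'x, 'y) goga \<Rightarrow> 'a \<Rightarrow> 'x set \<Rightarrow> bool" where
  "adhesion_set \<G> a S \<longleftrightarrow> (\<exists>\<Psi>. adhesion_map \<G> a \<Psi> \<and> S = \<Psi> ` aset \<G> a)"

definition regular_actions :: "('v, 'a, 'g, 'h) gog \<Rightarrow> ('v, 'a, 'g, 'h, 'g, 'h) goga" where
  "regular_actions \<G> =
     \<lparr>base = base \<G>, vgrp = vgrp \<G>, agrp = agrp \<G>,
      vset = (\<lambda>v. carrier (vgrp \<G> v)), vact = (\<lambda>v. left_regular (vgrp \<G> v)),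
      aset = (\<lambda>a. carrier (agrp \<G> a)), aact = (\<lambda>a. left_regular (agrp \<G> a)),
      emb = incl \<G>\<rparr>"

lemma perm_action_left_regular:
  assumes "group G" shows "perm_action G (carrier G) (left_regular G)"
proof -
  interpret group G by fact
  have bij: "left_regular G g \<in> Bij (carrier G)" if g: "g \<in> carrier G" for g
  proof -
    have "x \<in> (\<lambda>x. g \<otimes>\<^bsub>G\<^esub> x) ` carrier G" if "x \<in> carrier G" for x
      using g that by (intro image_eqI[of _ _ "inv\<^bsub>G\<^esub> g \<otimes>\<^bsub>G\<^esub> x"]) (auto simp flip: m_assoc)
    then show ?thesis
      using g by (auto simp: left_regular_def Bij_def bij_betw_def inj_on_def)
  qed
  have "left_regular G \<in> hom G (BijGroup (carrier G))"
    by (rule homI)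
      (auto simp: BijGroup_def bij left_regular_def compose_def fun_eq_iff restrict_def m_assoc
        dest: bij[unfolded left_regular_def restrict_def])
  moreover have "inj_on (left_regular G) (carrier G)"
    by (rule inj_onI) (metis left_regular_def one_closed r_one restrict_apply')
  ultimately show ?thesis
    using assms group_BijGroup one_closed
    by (auto simp: perm_action_def faithful_action_def faithful_action_axioms_def group_action_def
        group_hom_def group_hom_axioms_def)
qed

lemma perm_embedding_left_regular:
  assumes "group H" "group G" "\<theta> \<in> mon H G"
  shows "perm_embedding H (carrier H) (left_regular H) G (carrier G) (left_regular G) \<theta>"
proof -
  interpret group_hom H G \<theta>
    using assms by (auto simp: mon_def group_hom_def group_hom_axioms_def)
  have inj: "inj_on \<theta> (carrier H)" using assms by (simp add: mon_def)
  let ?Y = "\<theta> ` carrier H"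
  let ?f = "\<lambda>h. \<lambda>z\<in>?Y. \<theta> (left_regular H h (inv_into (carrier H) \<theta> z))"
  interpret Y: subgroup ?Y G by (rule img_is_subgroup)
  have f: "?f h = restrict (left_regular G (\<theta> h)) ?Y" if "h \<in> carrier H" for h
    using that inj by (auto simp: left_regular_def fun_eq_iff)
  have stab: "left_regular G g ` ?Y = ?Y \<longleftrightarrow> g \<in> ?Y" if g: "g \<in> carrier G" for g
  proof
    assume "left_regular G g ` ?Y = ?Y"
    then have "left_regular G g \<one>\<^bsub>G\<^esub> \<in> ?Y" using Y.one_closed by blast
    then show "g \<in> ?Y" using g by (simp add: left_regular_def)
  next
    assume "g \<in> ?Y"
    have eq: "left_regular G g ` ?Y = g <#\<^bsub>G\<^esub> ?Y"
      by (auto simp: left_regular_def l_coset_def)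
    show "left_regular G g ` ?Y = ?Y"
      unfolding eq using H.coset_join3[OF g Y.subgroup_axioms \<open>g \<in> ?Y\<close>] .
  qed
  have car: "carrier (induced_group G (left_regular G) ?Y) = ?f ` carrier H"
  proof -
    have "{g \<in> carrier G. left_regular G g ` ?Y = ?Y} = ?Y"
      using stab Y.subset by blast
    then show ?thesis
      unfolding induced_group_def using f by (force simp: image_iff)
  qed
  have bij: "?f h \<in> Bij ?Y" if "h \<in> carrier H" for h
  proof -
    have "left_regular G (\<theta> h) ` ?Y = ?Y" using stab[of "\<theta> h"] that by (simp del: image_image)
    moreover have "inj_on (left_regular G (\<theta> h)) ?Y"
      using that by (auto simp: inj_on_def left_regular_def)
    ultimately show ?thesis
      unfolding f[OF that] Bij_def bij_betw_def by (simp add: inj_on_restrict_eq del: restrict_apply)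
  qed
  have "?f \<in> iso H (induced_group G (left_regular G) ?Y)"
  proof (rule isoI)
    show "?f \<in> hom H (induced_group G (left_regular G) ?Y)"
    proof (rule homI)
      show "?f h \<in> carrier (induced_group G (left_regular G) ?Y)" if "h \<in> carrier H" for h
        using car that by blast
      fix h k assume hk: "h \<in> carrier H" "k \<in> carrier H"
      then have "?f (h \<otimes>\<^bsub>H\<^esub> k) = compose ?Y (?f h) (?f k)"
      proof -
        have "?f h (?f k z) = ?f (h \<otimes>\<^bsub>H\<^esub> k) z" if "z \<in> ?Y" for z
        proof -
          have "?f k z = \<theta> k \<otimes>\<^bsub>G\<^esub> z" "?f (h \<otimes>\<^bsub>H\<^esub> k) z = \<theta> h \<otimes>\<^bsub>G\<^esub> \<theta> k \<otimes>\<^bsub>G\<^esub> z"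
            unfolding f[OF hk(2)] f[OF G.m_closed[OF hk]] using that hk by (auto simp: left_regular_def)
          moreover have "?f h (\<theta> k \<otimes>\<^bsub>G\<^esub> z) = \<theta> h \<otimes>\<^bsub>G\<^esub> (\<theta> k \<otimes>\<^bsub>G\<^esub> z)"
            unfolding f[OF hk(1)] using that hk by (auto simp: left_regular_def)
          ultimately show ?thesis using that hk by (auto simp: H.m_assoc)
        qed
        then show ?thesis 
          by (intro extensionalityI[of _ ?Y]) (simp_all only: compose_extensional restrict_extensional compose_eq)
      qed
      then show "?f (h \<otimes>\<^bsub>H\<^esub> k) = ?f h \<otimes>\<^bsub>induced_group G (left_regular G) ?Y\<^esub> ?f k"
        using bij hk by (simp add: induced_group_def BijGroup_def)
    qed
    show "bij_betw ?f (carrier H) (carrier (induced_group G (left_regular G) ?Y))"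
      unfolding car bij_betw_def
    proof (intro conjI inj_onI)
      fix h k assume hk: "h \<in> carrier H" "k \<in> carrier H" "?f h = ?f k"
      have "?f h \<one>\<^bsub>G\<^esub> = ?f k \<one>\<^bsub>G\<^esub>" using hk(3) by (rule fun_cong)
      then have "\<theta> h = \<theta> k"
        unfolding f[OF hk(1)] f[OF hk(2)] using hk(1,2) Y.one_closed by (simp add: left_regular_def)
      then show "h = k" using inj hk by (auto dest: inj_onD)
    qed (rule HOL.refl)
  qed
  then show ?thesis using inj by (auto simp: perm_embedding_def)
qed

lemma graph_of_group_actions_regular_actions:
  assumes "graph_of_groups \<G>"
  shows "graph_of_group_actions (regular_actions \<G>)"
proof -
  interpret graph_of_groups \<G> by fact
  have fam: "head (base \<G>) a \<in> verts (base \<G>)" if "a \<in> arcs (base \<G>)" for a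
  proof -
    interpret connected_rgraph "base \<G>" by (rule connected_base)
    show ?thesis using head_in_verts[of a] that by (simp add: pre_digraph.truncate_def)
  qed
  show ?thesis
    using connected_base no_self_reverse
    by (intro graph_of_group_actions.intro group_family.intro graph_of_group_actions_axioms.intro)
      (simp_all add: regular_actions_def group_vgrp group_agrp agrp_arev perm_action_left_regular
        perm_embedding_left_regular incl_mon fam)
qed


section \<open>Scaffoldings and universal groups\<close>

definition arc_rel :: "('s, 'b) pre_rgraph \<Rightarrow> 's rel \<Rightarrow> 'b rel" where
  "arc_rel \<Sigma> R = {(a, b). a \<in> arcs \<Sigma> \<and> b \<in> arcs \<Sigma> \<and>
     (tail \<Sigma> a, tail \<Sigma> b) \<in> R \<and> (head \<Sigma> a, head \<Sigma> b) \<in> R}"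

definition quotient_graph :: "('s, 'b) pre_rgraph \<Rightarrow> 's rel \<Rightarrow> ('s set, 'b set) pre_rgraph" where
  "quotient_graph \<Sigma> R =
     \<lparr>verts = verts \<Sigma> // R, arcs = arcs \<Sigma> // arc_rel \<Sigma> R,
      tail = (\<lambda>D. \<Union>a\<in>D. R `` {tail \<Sigma> a}), head = (\<lambda>D. \<Union>a\<in>D. R `` {head \<Sigma> a}),
      arev = (\<lambda>D. arev \<Sigma> ` D)\<rparr>"

text \<open>The projection to the base graph is split into \<open>vproj\<close> and \<open>aproj\<close>, the legal colouring
  into \<open>vcol\<close> and \<open>acol\<close>.\<close>

record ('v, 'a, 'x, 'y, 's, 'b) scaffold =
  sgraph :: "('s, 'b) pre_rgraph"
  srel :: "'s rel"
  vproj :: "'s set \<Rightarrow> 'v"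
  aproj :: "'b set \<Rightarrow> 'a"
  vcol :: "'s \<Rightarrow> 'x"
  acol :: "'b \<Rightarrow> 'y"

definition stree :: "('v, 'a, 'x, 'y, 's, 'b) scaffold \<Rightarrow> ('s set, 'b set) pre_rgraph" where
  "stree S = quotient_graph (sgraph S) (srel S)"

text \<open>The map sending the colour of each arc in the class \<open>D\<close> to the colour of its terminus.\<close>

definition col_map :: "('v, 'a, 'x, 'y, 's, 'b) scaffold \<Rightarrow> 'b set \<Rightarrow> 'y \<Rightarrow> 'x" where
  "col_map S D y = vcol S (head (sgraph S) (inv_into D (acol S) y))"

locale scaffolding = graph_of_group_actions \<G> + rgraph "sgraph S"
  for \<G> :: "('v, 'a, 'g, 'h, 'x, 'y) goga" and S :: "('v, 'a, 'x, 'y, 's, 'b) scaffold" +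
  assumes equiv_srel: "equiv (verts (sgraph S)) (srel S)"
    and rtree_stree: "rtree (stree S)"
    and ends_not_related: "b \<in> arcs (sgraph S) \<Longrightarrow>
      (tail (sgraph S) b, head (sgraph S) b) \<notin> srel S"
    and proj_hom: "rgraph_hom (stree S) (base \<G>) (vproj S) (aproj S)"
    and vcol_bij: "C \<in> verts (stree S) \<Longrightarrow> bij_betw (vcol S) C (vset \<G> (vproj S C))"
    and acol_bij: "D \<in> arcs (stree S) \<Longrightarrow> bij_betw (acol S) D (aset \<G> (aproj S D))"
    and acol_arev: "b \<in> arcs (sgraph S) \<Longrightarrow> acol S (arev (sgraph S) b) = acol S b"
    and col_map_adhesion: "D \<in> arcs (stree S) \<Longrightarrow> adhesion_map \<G> (aproj S D) (col_map S D)"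
    and unique_arc: "\<lbrakk>C \<in> verts (stree S); a \<in> arcs (base \<G>); head (base \<G>) a = vproj S C;
        adhesion_set \<G> a Z\<rbrakk> \<Longrightarrow>
      \<exists>!D. D \<in> arcs (stree S) \<and> head (stree S) D = C \<and> aproj S D = a \<and>
           col_map S D ` aset \<G> a = Z"

definition local_perm ::
  "('v, 'a, 'g, 'h, 'x, 'y) goga \<Rightarrow> ('v, 'a, 'x, 'y, 's, 'b) scaffold \<Rightarrow> ('s \<Rightarrow> 's) \<Rightarrow> 's set \<Rightarrow> 'x \<Rightarrow> 'x"
  where
  "local_perm \<G> S f C = (\<lambda>z\<in>vset \<G> (vproj S C). vcol S (f (inv_into C (vcol S) z)))"

definition universal_group ::
  "('v, 'a, 'g, 'h, 'x, 'y) goga \<Rightarrow> ('v, 'a, 'x, 'y, 's, 'b) scaffold \<Rightarrow>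
     (('s \<Rightarrow> 's) \<times> ('b \<Rightarrow> 'b)) monoid" where
  "universal_group \<G> S =
     (BijGroup (verts (sgraph S)) \<times>\<times> BijGroup (arcs (sgraph S)))
       \<lparr>carrier := {(f, f'). f \<in> Bij (verts (sgraph S)) \<and> f' \<in> Bij (arcs (sgraph S)) \<and>
          rgraph_hom (sgraph S) (sgraph S) f f' \<and>
          (\<forall>x\<in>verts (sgraph S). \<forall>y\<in>verts (sgraph S). (f x, f y) \<in> srel S \<longleftrightarrow> (x, y) \<in> srel S) \<and>
          (\<forall>x\<in>verts (sgraph S). vproj S (srel S `` {f x}) = vproj S (srel S `` {x})) \<and>
          (\<forall>b\<in>arcs (sgraph S). aproj S (arc_rel (sgraph S) (srel S) `` {f' b}) =
             aproj S (arc_rel (sgraph S) (srel S) `` {b})) \<and>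
          (\<forall>C\<in>verts (stree S).
             local_perm \<G> S f C \<in> vact \<G> (vproj S C) ` carrier (vgrp \<G> (vproj S C)))}\<rparr>"

definition universal_action ::
  "('v, 'a, 'g, 'h, 'x, 'y) goga \<Rightarrow> ('v, 'a, 'x, 'y, 's, 'b) scaffold \<Rightarrow>
     (('s \<Rightarrow> 's) \<times> ('b \<Rightarrow> 'b), 's set, 'b set) graph_action" where
  "universal_action \<G> S =
     \<lparr>agroup = universal_group \<G> S, agraph = stree S,
      on_verts = (\<lambda>(f, f') C. f ` C), on_arcs = (\<lambda>(f, f') D. f' ` D)\<rparr>"


section \<open>Fundamental groups and Bass--Serre trees\<close>

text \<open>
  Serre's group \<open>\<pi>\<^sub>1(\<G>, T)\<close> for a spanning tree \<open>T\<close> with arc set \<open>E\<close>: the generators are the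
  elements of the vertex groups and the arcs \<open>a\<close>, and the relations are those of the vertex groups
  together with \<open>arev a = inverse a\<close>, \<open>a \<cdot> incl a h \<cdot> inverse a = incl (arev a) h\<close>, and \<open>a = 1\<close>
  for \<open>a \<in> E\<close>. The generating set is closed under inversion, so the monoid with this presentation
  is already the group.
\<close>

datatype ('v, 'a, 'g) letter = Elem 'v 'g | Arc 'a

definition letters :: "('v, 'a, 'g, 'h) gog \<Rightarrow> ('v, 'a, 'g) letter set" where
  "letters \<G> = {Elem v g | v g. v \<in> verts (base \<G>) \<and> g \<in> carrier (vgrp \<G> v)} \<union>
     Arc ` arcs (base \<G>)"

inductive_set word_rel :: "('v, 'a, 'g, 'h) gog \<Rightarrow> 'a set \<Rightarrow> ('v, 'a, 'g) letter list rel"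
  for \<G> :: "('v, 'a, 'g, 'h) gog" and E :: "'a set" where
  refl: "w \<in> lists (letters \<G>) \<Longrightarrow> (w, w) \<in> word_rel \<G> E"
| sym: "(u, w) \<in> word_rel \<G> E \<Longrightarrow> (w, u) \<in> word_rel \<G> E"
| trans: "\<lbrakk>(u, w) \<in> word_rel \<G> E; (w, x) \<in> word_rel \<G> E\<rbrakk> \<Longrightarrow> (u, x) \<in> word_rel \<G> E"
| append: "\<lbrakk>(u, w) \<in> word_rel \<G> E; (u', w') \<in> word_rel \<G> E\<rbrakk> \<Longrightarrow> (u @ u', w @ w') \<in> word_rel \<G> E"
| one: "v \<in> verts (base \<G>) \<Longrightarrow> ([Elem v \<one>\<^bsub>vgrp \<G> v\<^esub>], []) \<in> word_rel \<G> E"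
| mult: "\<lbrakk>v \<in> verts (base \<G>); g \<in> carrier (vgrp \<G> v); k \<in> carrier (vgrp \<G> v)\<rbrakk> \<Longrightarrow>
    ([Elem v g, Elem v k], [Elem v (g \<otimes>\<^bsub>vgrp \<G> v\<^esub> k)]) \<in> word_rel \<G> E"
| arev: "a \<in> arcs (base \<G>) \<Longrightarrow> ([Arc a, Arc (arev (base \<G>) a)], []) \<in> word_rel \<G> E"
| conj: "\<lbrakk>a \<in> arcs (base \<G>); h \<in> carrier (agrp \<G> a)\<rbrakk> \<Longrightarrow>
    ([Arc a, Elem (head (base \<G>) a) (incl \<G> a h), Arc (arev (base \<G>) a)],
     [Elem (tail (base \<G>) a) (incl \<G> (arev (base \<G>) a) h)]) \<in> word_rel \<G> E"
| tree: "a \<in> E \<inter> arcs (base \<G>) \<Longrightarrow> ([Arc a], []) \<in> word_rel \<G> E"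

definition fundamental_group ::
  "('v, 'a, 'g, 'h) gog \<Rightarrow> 'a set \<Rightarrow> ('v, 'a, 'g) letter list set monoid" where
  "fundamental_group \<G> E =
     \<lparr>carrier = lists (letters \<G>) // word_rel \<G> E,
      mult = (\<lambda>U W. \<Union>u\<in>U. \<Union>w\<in>W. word_rel \<G> E `` {u @ w}),
      one = word_rel \<G> E `` {[]}\<rparr>"

lemma equiv_word_rel: "graph_of_groups \<G> \<Longrightarrow> equiv (lists (letters \<G>)) (word_rel \<G> E)"
proof -
  assume "graph_of_groups \<G>"
  interpret graph_of_groups \<G> by fact
  interpret connected_rgraph "base \<G>" by (rule connected_base)
  have hd: "head (base \<G>) a \<in> verts (base \<G>)" "tail (base \<G>) a \<in> verts (base \<G>)" if "a \<in> arcs (base \<G>)" for a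
    using head_in_verts[of a] tail_in_verts[of a] that by (simp_all add: pre_digraph.truncate_def)
  have inc: "incl \<G> a h \<in> carrier (vgrp \<G> (head (base \<G>) a))" if "a \<in> arcs (base \<G>)" "h \<in> carrier (agrp \<G> a)" for a h
    using incl_mon[OF that(1)] that by (auto simp: mon_def hom_def)
  have inc': "incl \<G> (arev (base \<G>) a) h \<in> carrier (vgrp \<G> (tail (base \<G>) a))" if "a \<in> arcs (base \<G>)" "h \<in> carrier (agrp \<G> a)" for a h
  proof -
    have "head (base \<G>) (arev (base \<G>) a) = tail (base \<G>) a"
      using tail_arev[OF arev_in_arcs[OF that(1)]] arev_arev[OF that(1)] by simp
    then show ?thesis using inc[OF arev_in_arcs[OF that(1)]] agrp_arev that by simp
  qed
  have sub: "u \<in> lists (letters \<G>) \<and> w \<in> lists (letters \<G>)" if "(u,w) \<in> word_rel \<G> E" for u w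
    using that
  proof induction
    case (one v) then show ?case using group_vgrp[of v] by (auto simp: letters_def group.is_monoid monoid.one_closed)
  next
    case (mult v g k) then show ?case using group_vgrp[of v] by (auto simp: letters_def group.is_monoid monoid.m_closed)
  next
    case (arev a) then show ?case by (auto simp: letters_def arev_in_arcs)
  next
    case (conj a h) then show ?case using hd inc inc' by (auto simp: letters_def arev_in_arcs)
  next
    case (tree a) then show ?case by (auto simp: letters_def)
  qed (auto simp del: in_lists_conv_set)
  show ?thesis
    by (rule equivI) (use sub in \<open>auto simp: refl_on_def sym_def trans_def simp del: in_lists_conv_set intro: word_rel.intros\<close>)
qed

lemma group_fundamental_group: 
  assumes "graph_of_groups \<G>"
  shows "group (fundamental_group \<G> E)"
proof -
  interpret graph_of_groups \<G> by fact
  interpret connected_rgraph "base \<G>" by (rule connected_base)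
  let ?R = "word_rel \<G> E" and ?W = "lists (letters \<G>)"
  note eq = equiv_word_rel[OF assms, of E]
  have mult: "mult (fundamental_group \<G> E) (?R``{u}) (?R``{w}) = ?R `` {u@w}" if "u \<in> ?W" "w \<in> ?W" for u w
    unfolding fundamental_group_def monoid.simps
    by (rule UN_equiv_class2[OF eq eq _ that, of "\<lambda>u w. ?R `` {u@w}"])
      (auto simp: congruent2_def intro!: equiv_class_eq[OF eq] word_rel.append)
  have inv: "\<exists>u\<in>?W. (u@w,[]) \<in> ?R" if "w \<in> ?W" for w using that
  proof (induction w)
    case Nil then show ?case by (auto intro!: bexI[of _ "[]"] word_rel.refl)
  next
    case (Cons l w)
    then obtain u where u: "u \<in> ?W" "(u@w,[]) \<in> ?R" by auto
    obtain k where k: "k \<in> letters \<G>" "([k,l],[]) \<in> ?R"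
    proof (cases l)
      case (Elem v g)
      then have v: "v \<in> verts (base \<G>)" "g \<in> carrier (vgrp \<G> v)" using Cons by (auto simp: letters_def)
      then interpret v: group "vgrp \<G> v" using group_vgrp by blast
      have "([Elem v (inv\<^bsub>vgrp \<G> v\<^esub> g), Elem v g], [Elem v (inv\<^bsub>vgrp \<G> v\<^esub> g \<otimes>\<^bsub>vgrp \<G> v\<^esub> g)]) \<in> ?R"
        using v by (intro word_rel.mult) auto
      then show ?thesis using v Elem by (intro that[of "Elem v (inv\<^bsub>vgrp \<G> v\<^esub> g)"]) (auto simp: letters_def intro: word_rel.trans word_rel.one)
    next
      case (Arc a)
      then have a: "a \<in> arcs (base \<G>)" using Cons by (auto simp: letters_def)
      show ?thesis using a Arc word_rel.arev[OF arev_in_arcs[OF a], of E] arev_in_arcs[OF a] arev_arev[OF a]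
        by (intro that[of "Arc (arev (base \<G>) a)"]) (auto simp: letters_def)
    qed
    have "([]@w, [k,l]@w) \<in> ?R" using k Cons by (intro word_rel.append) (auto intro: word_rel.sym word_rel.refl simp del: in_lists_conv_set)
    then have "(u@([]@w), u@([k,l]@w)) \<in> ?R" by (rule word_rel.append[OF word_rel.refl[OF u(1)]])
    then have "((u@[k])@(l#w),[]) \<in> ?R" using word_rel.trans[OF word_rel.sym u(2)] by simp
    then show ?case using u k by (intro bexI[of _ "u@[k]"]) auto
  qed
  have car: "x \<in> carrier (fundamental_group \<G> E) \<longleftrightarrow> (\<exists>w\<in>?W. x = ?R``{w})" for x
    by (auto simp: fundamental_group_def quotient_def)
  have one: "\<one>\<^bsub>fundamental_group \<G> E\<^esub> = ?R``{[]}" by (simp add: fundamental_group_def)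
  have app: "u @ w \<in> ?W" if "u \<in> ?W" "w \<in> ?W" for u w using that by simp
  have cls: "?R``{u} \<in> carrier (fundamental_group \<G> E)" if "u \<in> ?W" for u
    using that unfolding car by blast
  have ex: "\<exists>w\<in>?W. x = ?R``{w}" if "x \<in> carrier (fundamental_group \<G> E)" for x
    using that unfolding car .
  show ?thesis
  proof (rule groupI)
    show "\<one>\<^bsub>fundamental_group \<G> E\<^esub> \<in> carrier (fundamental_group \<G> E)"
      unfolding one by (intro cls) simp
  next
    fix x y assume "x \<in> carrier (fundamental_group \<G> E)" "y \<in> carrier (fundamental_group \<G> E)"
    then obtain u w where uw: "u \<in> ?W" "w \<in> ?W" and x: "x = ?R``{u}" and y: "y = ?R``{w}"
      using ex by meson
    show "x \<otimes>\<^bsub>fundamental_group \<G> E\<^esub> y \<in> carrier (fundamental_group \<G> E)"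
      unfolding x y mult[OF uw] by (intro cls app uw)
    fix z assume "z \<in> carrier (fundamental_group \<G> E)"
    then obtain t where t: "t \<in> ?W" and z: "z = ?R``{t}" using ex by meson
    show "x \<otimes>\<^bsub>fundamental_group \<G> E\<^esub> y \<otimes>\<^bsub>fundamental_group \<G> E\<^esub> z =
        x \<otimes>\<^bsub>fundamental_group \<G> E\<^esub> (y \<otimes>\<^bsub>fundamental_group \<G> E\<^esub> z)"
      unfolding x y z mult[OF uw] mult[OF uw(2) t] mult[OF app[OF uw] t] mult[OF uw(1) app[OF uw(2) t]]
      by simp
  next
    fix x assume "x \<in> carrier (fundamental_group \<G> E)"
    then obtain w where w: "w \<in> ?W" and x: "x = ?R``{w}" using ex by meson
    have "[] \<in> ?W" by simp
    then show "\<one>\<^bsub>fundamental_group \<G> E\<^esub> \<otimes>\<^bsub>fundamental_group \<G> E\<^esub> x = x"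
      unfolding one x using mult[OF _ w] by simp
    obtain u where u: "u \<in> ?W" "(u @ w, []) \<in> ?R" using inv[OF w] by meson
    have "?R``{u} \<otimes>\<^bsub>fundamental_group \<G> E\<^esub> x = \<one>\<^bsub>fundamental_group \<G> E\<^esub>"
      unfolding x one mult[OF u(1) w] by (rule equiv_class_eq[OF eq u(2)])
    then show "\<exists>y\<in>carrier (fundamental_group \<G> E).
        y \<otimes>\<^bsub>fundamental_group \<G> E\<^esub> x = \<one>\<^bsub>fundamental_group \<G> E\<^esub>"
      using cls[OF u(1)] by (intro bexI)
  qed
qed

definition gen_elem ::
  "('v, 'a, 'g, 'h) gog \<Rightarrow> 'a set \<Rightarrow> 'v \<Rightarrow> 'g \<Rightarrow> ('v, 'a, 'g) letter list set" where
  "gen_elem \<G> E v g = word_rel \<G> E `` {[Elem v g]}"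

definition gen_arc :: "('v, 'a, 'g, 'h) gog \<Rightarrow> 'a set \<Rightarrow> 'a \<Rightarrow> ('v, 'a, 'g) letter list set" where
  "gen_arc \<G> E a = word_rel \<G> E `` {[Arc a]}"

definition vert_subgroup ::
  "('v, 'a, 'g, 'h) gog \<Rightarrow> 'a set \<Rightarrow> 'v \<Rightarrow> ('v, 'a, 'g) letter list set set" where
  "vert_subgroup \<G> E v = gen_elem \<G> E v ` carrier (vgrp \<G> v)"

text \<open>
  For an arc \<open>a\<close> of the orientation \<open>A\<close>, the subgroup of \<open>a\<close> and of its reverse is the image of
  the arc group in the vertex group at the origin of \<open>a\<close>.
\<close>

definition arc_subgroup ::
  "('v, 'a, 'g, 'h) gog \<Rightarrow> 'a set \<Rightarrow> 'a set \<Rightarrow> 'a \<Rightarrow> ('v, 'a, 'g) letter list set set" where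
  "arc_subgroup \<G> E A a =
     (let c = (if a \<in> A then a else arev (base \<G>) a)
      in gen_elem \<G> E (tail (base \<G>) c) ` incl \<G> (arev (base \<G>) c) ` carrier (agrp \<G> c))"

text \<open>
  Vertices are the cosets of the vertex subgroups and arcs those of the arc subgroups, both tagged
  with the vertex or arc of the base graph they lie over. With \<open>e = 0\<close> for \<open>a \<in> A\<close> and \<open>e = 1\<close>
  otherwise, the arc \<open>x \<cdot> arc_subgroup a\<close> goes from the coset of \<open>x \<cdot> a\<^sup>-\<^sup>e\<close> to that of
  \<open>x \<cdot> a\<^sup>1\<^sup>-\<^sup>e\<close>.
\<close>

definition bass_serre_tree ::
  "('v, 'a, 'g, 'h) gog \<Rightarrow> 'a set \<Rightarrow> 'a set \<Rightarrow>
     ('v \<times> ('v, 'a, 'g) letter list set set, 'a \<times> ('v, 'a, 'g) letter list set set) pre_rgraph"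
  where
  "bass_serre_tree \<G> E A =
     (let P = fundamental_group \<G> E; \<Delta> = base \<G> in
      \<lparr>verts = {(v, x <#\<^bsub>P\<^esub> vert_subgroup \<G> E v) | v x. v \<in> verts \<Delta> \<and> x \<in> carrier P},
       arcs = {(a, x <#\<^bsub>P\<^esub> arc_subgroup \<G> E A a) | a x. a \<in> arcs \<Delta> \<and> x \<in> carrier P},
       tail = (\<lambda>(a, D). (tail \<Delta> a,
         \<Union>x\<in>D. (if a \<in> A then x else x \<otimes>\<^bsub>P\<^esub> inv\<^bsub>P\<^esub> gen_arc \<G> E a) <#\<^bsub>P\<^esub> vert_subgroup \<G> E (tail \<Delta> a))),
       head = (\<lambda>(a, D). (head \<Delta> a,
         \<Union>x\<in>D. (if a \<in> A then x \<otimes>\<^bsub>P\<^esub> gen_arc \<G> E a else x) <#\<^bsub>P\<^esub> vert_subgroup \<G> E (head \<Delta> a))),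
       arev = (\<lambda>(a, D). (arev \<Delta> a, D))\<rparr>)"

definition bass_serre_action ::
  "('v, 'a, 'g, 'h) gog \<Rightarrow> 'a set \<Rightarrow> 'a set \<Rightarrow>
     (('v, 'a, 'g) letter list set,
      'v \<times> ('v, 'a, 'g) letter list set set, 'a \<times> ('v, 'a, 'g) letter list set set) graph_action"
  where
  "bass_serre_action \<G> E A =
     \<lparr>agroup = fundamental_group \<G> E, agraph = bass_serre_tree \<G> E A,
      on_verts = (\<lambda>k (v, C). (v, k <#\<^bsub>fundamental_group \<G> E\<^esub> C)),
      on_arcs = (\<lambda>k (a, D). (a, k <#\<^bsub>fundamental_group \<G> E\<^esub> D))\<rparr>"

end

theory Submission
  imports Defs
begin

text \<open>
  For regular actions the adhesion sets at a vertex are the cosets of the arc groups, so they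
  partition each class of the scaffolding, and the scaffolding graph is a covering of the base graph.
  Writing \<open>P\<close> for the fundamental group, every vertex \<open>x\<close> of the scaffolding receives a coordinate in
  \<open>P\<close>: inside a class it changes by the quotient of the colours, along an arc over \<open>a\<close> by the
  generator \<open>a\<close>. There is no monodromy because \<open>T\<^sub>\<Sigma>\<close> is a tree. Together with the
  projection to the base graph, the coordinate identifies the vertices with \<open>P \<times> V\<Delta>\<close>.
  Surjectivity follows by walking along words; injectivity holds because words of generators act on
  the vertices from the right, and this action respects the defining relations of \<open>P\<close>. In these
  coordinates the universal group is \<open>P\<close> acting by left multiplication, and the classes are the
  cosets which make up the Bass--Serre tree.
\<close>

section \<open>Trees\<close>

text \<open>Equality in \<open>P\<close> is known only through the presentation, so distinguishing
  two elements requires something on which the presented group acts. The obstacle is that a letter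
  makes sense over one base vertex only, while consecutive letters of a word are arbitrary; the
  spanning tree, whose arcs are trivial in \<open>P\<close>, supplies the missing paths. Left and
  right are kept apart throughout: acceptability for a regular action means that the colours of a
  class are multiplied on the left by a single element, so the quotient
  \<open>inv g \<otimes> k\<close> of two colours is invariant, and coordinates that change on the
  right turn automorphisms into left multiplications. The absence of monodromy over the quotient
  tree and the triviality of the covering over the spanning tree are the same fact about trees,
  applied to different fibres.\<close>

lemma dg_simps [simp]:
  "verts (dg \<Gamma>) = verts \<Gamma>" "arcs (dg \<Gamma>) = arcs \<Gamma>" "tail (dg \<Gamma>) = tail \<Gamma>" "head (dg \<Gamma>) = head \<Gamma>"
  by (simp_all add: pre_digraph.truncate_def)

context rgraph
begin

lemma tail_closed: "a \<in> arcs \<Gamma> \<Longrightarrow> tail \<Gamma> a \<in> verts \<Gamma>"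
  using tail_in_verts[of a] by simp

lemma head_closed: "a \<in> arcs \<Gamma> \<Longrightarrow> head \<Gamma> a \<in> verts \<Gamma>"
  using head_in_verts[of a] by simp

lemma head_arev: "a \<in> arcs \<Gamma> \<Longrightarrow> head \<Gamma> (arev \<Gamma> a) = tail \<Gamma> a"
  using tail_arev[OF arev_in_arcs] arev_arev by simp

end

context connected_rgraph
begin

lemma verts_nonempty: "verts \<Gamma> \<noteq> {}"
  using connected by (auto simp: strongly_connected_def)

lemma ex_awalk: "u \<in> verts \<Gamma> \<Longrightarrow> v \<in> verts \<Gamma> \<Longrightarrow> \<exists>p. awalk u p v"
  using connected by (auto simp: strongly_connected_def reachable_awalk)

lemma awalk_invariant:
  assumes "awalk u p v" "Q u"
    and "\<And>a. a \<in> arcs \<Gamma> \<Longrightarrow> Q (tail \<Gamma> a) \<Longrightarrow> Q (head \<Gamma> a)"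
  shows "Q v"
  using assms(1,2) by (induction p arbitrary: u) (auto simp: awalk_simps intro: assms(3))

lemma connected_induct:
  assumes "u \<in> verts \<Gamma>" "v \<in> verts \<Gamma>" "Q u"
    and "\<And>a. a \<in> arcs \<Gamma> \<Longrightarrow> Q (tail \<Gamma> a) \<Longrightarrow> Q (head \<Gamma> a)"
  shows "Q v"
  using ex_awalk[OF assms(1,2)] awalk_invariant[of u _ v Q] assms(3,4) by blast

end

context rtree
begin

text \<open>A closed walk with no repetition after its start is a cycle, so it has at most two arcs;
  a single arc would be a loop, and two arcs are mutually reverse because there are no multiple
  arcs. If there is a repetition, a shorter closed walk sits inside and induction applies.\<close>

lemma closed_awalk_backtracks:
  assumes "awalk u p u" "p \<noteq> []"
  shows "\<exists>q a r. p = q @ a # arev \<Gamma> a # r"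
  using assms
proof (induction "length p" arbitrary: u p rule: less_induct)
  case less
  show ?case
  proof (cases "distinct (tl (awalk_verts u p))")
    case True
    then have "length p < 3"
      using less.prems by (intro no_long_cycle) (auto simp: cycle_def)
    moreover have "length p \<noteq> 0" using less.prems by simp
    moreover have "length p \<noteq> 1"
    proof
      assume "length p = 1"
      then obtain a where "p = [a]" by (auto simp: length_Suc_conv)
      then show False using less.prems no_loops[of a] by (auto simp: awalk_simps)
    qed
    ultimately have "length p = 2" by linarith
    then obtain a b where p: "p = [a, b]"
      by (auto simp: length_Suc_conv numeral_2_eq_2)
    have ab: "a \<in> arcs \<Gamma>" "b \<in> arcs \<Gamma>" "tail \<Gamma> b = head \<Gamma> a" "head \<Gamma> b = tail \<Gamma> a"
      using less.prems p by (auto simp: awalk_simps)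
    then have "b = arev \<Gamma> a"
      by (intro no_multi_arcs) (auto simp: arc_to_ends_def arev_in_arcs tail_arev head_arev)
    then show ?thesis using p by (metis append_Nil)
  next
    case False
    obtain e es where p: "p = e # es" using less.prems by (cases p) auto
    have es: "awalk (head \<Gamma> e) es u" using less.prems p by (auto simp: awalk_simps)
    have "\<not> distinct (awalk_verts (head \<Gamma> e) es)" using False p by simp
    from awalk_not_distinct_decomp[OF es this] obtain q r s w
      where d: "es = q @ r @ s" "0 < length r" "awalk w r w" by metis
    then obtain q' a r' where "r = q' @ a # arev \<Gamma> a # r'"
      using less.hyps[of r w] p by auto
    then have "p = (e # q @ q') @ a # arev \<Gamma> a # (r' @ s)" using p d by simp
    then show ?thesis by blast
  qed
qed

text \<open>A family of fibres over a tree with invertible transition maps \<open>t\<close> is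
  trivial: folding \<open>t\<close> along a walk depends only on the ends, since a closed walk loses
  its backtracks one by one. It serves for \<open>stree S\<close> with every fibre equal to the
  group, and for the spanning tree of the base graph with the fibres of the covering.\<close>

lemma transport_exists:
  assumes closed: "\<And>a s. a \<in> arcs \<Gamma> \<Longrightarrow> s \<in> F (tail \<Gamma> a) \<Longrightarrow> t a s \<in> F (head \<Gamma> a)"
    and undo: "\<And>a s. a \<in> arcs \<Gamma> \<Longrightarrow> s \<in> F (tail \<Gamma> a) \<Longrightarrow> t (arev \<Gamma> a) (t a s) = s"
  shows "\<exists>\<tau>. (\<forall>u\<in>verts \<Gamma>. \<forall>v\<in>verts \<Gamma>. \<forall>s\<in>F u. \<tau> u v s \<in> F v) \<and>
    (\<forall>u\<in>verts \<Gamma>. \<forall>s\<in>F u. \<tau> u u s = s) \<and>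
    (\<forall>u\<in>verts \<Gamma>. \<forall>v\<in>verts \<Gamma>. \<forall>w\<in>verts \<Gamma>. \<forall>s\<in>F u. \<tau> v w (\<tau> u v s) = \<tau> u w s) \<and>
    (\<forall>a\<in>arcs \<Gamma>. \<forall>s\<in>F (tail \<Gamma> a). \<tau> (tail \<Gamma> a) (head \<Gamma> a) s = t a s)"
proof -
  have fold_closed: "fold t p s \<in> F v" if "awalk u p v" "s \<in> F u" for u p v s
    using that by (induction p arbitrary: u s) (auto simp: awalk_simps closed)
  have loop: "fold t p s = s" if "awalk u p u" "s \<in> F u" for u p s
    using that
  proof (induction "length p" arbitrary: p rule: less_induct)
    case less
    show ?case
    proof (cases "p = []")
      case False
      then obtain q a r where p: "p = q @ a # arev \<Gamma> a # r"
        using closed_awalk_backtracks less.prems by blast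
      have q: "awalk u q (tail \<Gamma> a)" and a: "a \<in> arcs \<Gamma>"
        and r: "awalk (tail \<Gamma> a) r u"
        using less.prems p by (auto simp: awalk_simps head_arev dest: awalk_ends_eqD)
      have "fold t p s = fold t (q @ r) s"
        using p undo[OF a] fold_closed[OF q less.prems(2)] by simp
      also have "\<dots> = s"
        using less.hyps[of "q @ r"] awalk_appendI[OF q r] p less.prems(2) by simp
      finally show ?thesis .
    qed simp
  qed
  have indep: "fold t p s = fold t q s" if "awalk u p v" "awalk u q v" "s \<in> F u" for u v p q s
  proof -
    have v: "u \<in> verts \<Gamma>" "v \<in> verts \<Gamma>"
      using reachable_in_verts[OF reachable_awalkI[OF that(1)]] by auto
    \<comment> \<open>A common return walk: \<open>p @ r\<close> and \<open>r @ q\<close> are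
      closed, so acting by \<open>p\<close>, \<open>r\<close>, \<open>q\<close> in succession gives
      the result of \<open>q\<close> alone and also that of \<open>p\<close> alone.\<close>
    obtain r where r: "awalk v r u"
      using ex_awalk v by blast
    have "fold t (p @ r) s = s" by (rule loop[OF awalk_appendI[OF that(1) r] that(3)])
    then have 1: "fold t q (fold t r (fold t p s)) = fold t q s" by simp
    have "fold t (r @ q) (fold t p s) = fold t p s"
      by (rule loop[OF awalk_appendI[OF r that(2)] fold_closed[OF that(1,3)]])
    with 1 show ?thesis by simp
  qed
  define \<tau> where "\<tau> u v = fold t (SOME p. awalk u p v)" for u v
  have \<tau>: "\<tau> u v s = fold t p s" if "awalk u p v" "s \<in> F u" for u v p s
    unfolding \<tau>_def using indep[OF someI[of "\<lambda>p. awalk u p v", OF that(1)]] that by blast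
  have "\<tau> u v s \<in> F v" if "u \<in> verts \<Gamma>" "v \<in> verts \<Gamma>" "s \<in> F u" for u v s
    using ex_awalk[OF that(1,2)] \<tau> fold_closed that by metis
  moreover have "\<tau> u u s = s" if "u \<in> verts \<Gamma>" "s \<in> F u" for u s
    using \<tau>[of u "[]" u s] that by (simp add: awalk_simps)
  moreover have "\<tau> v w (\<tau> u v s) = \<tau> u w s"
    if uvw: "u \<in> verts \<Gamma>" "v \<in> verts \<Gamma>" "w \<in> verts \<Gamma>" and s: "s \<in> F u" for u v w s
  proof -
    obtain p q where pq: "awalk u p v" "awalk v q w" using ex_awalk uvw by blast
    then show ?thesis
      using \<tau>[OF pq(1) s] \<tau>[OF pq(2) fold_closed[OF pq(1) s]] \<tau>[OF awalk_appendI[OF pq] s] by simp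
  qed
  moreover have "\<tau> (tail \<Gamma> a) (head \<Gamma> a) s = t a s" if "a \<in> arcs \<Gamma>" "s \<in> F (tail \<Gamma> a)" for a s
    using \<tau>[of "tail \<Gamma> a" "[a]" "head \<Gamma> a" s] that by (simp add: awalk_simps tail_closed head_closed)
  ultimately show ?thesis by (intro exI[of _ \<tau>]) blast
qed

end

section \<open>The fundamental group\<close>

context group
begin

lemma mult_inv_cancel [simp]:
  assumes "x \<in> carrier G" "y \<in> carrier G"
  shows "x \<otimes> (inv x \<otimes> y) = y" "inv x \<otimes> (x \<otimes> y) = y"
  using assms by (simp_all flip: m_assoc)

lemma inv_mult_eq_oneD:
  assumes "x \<in> carrier G" "y \<in> carrier G" "inv x \<otimes> y = \<one>"
  shows "x = y"
  using assms mult_inv_cancel(1)[of x y] by simp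

end

lemma (in group_hom) shift_left_factor:
  assumes "g \<in> carrier H" "k \<in> carrier G" "k' \<in> carrier G"
  shows "(g \<otimes>\<^bsub>H\<^esub> h k) \<otimes>\<^bsub>H\<^esub> h (inv k \<otimes> k') = g \<otimes>\<^bsub>H\<^esub> h k'"
  using assms by (simp add: H.m_assoc)

locale presented_group = graph_of_groups \<G> for \<G> :: "('v, 'a, 'g, 'h) gog" +
  fixes E :: "'a set"
  assumes spanning: "spanning_tree_arcs (base \<G>) E"
begin

abbreviation "P \<equiv> fundamental_group \<G> E"

abbreviation cls :: "('v, 'a, 'g) letter list \<Rightarrow> ('v, 'a, 'g) letter list set" where
  "cls w \<equiv> word_rel \<G> E `` {w}"

sublocale base: connected_rgraph "base \<G>"
  by (rule connected_base)

sublocale span: rtree "base \<G>\<lparr>arcs := E\<rparr>"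
  using spanning by (simp add: spanning_tree_arcs_def)

lemma span_arcs: "a \<in> E \<Longrightarrow> a \<in> arcs (base \<G>)"
  using spanning by (auto simp: spanning_tree_arcs_def)

sublocale P: group P
  by (rule group_fundamental_group) unfold_locales

lemma equiv_words: "equiv (lists (letters \<G>)) (word_rel \<G> E)"
  by (rule equiv_word_rel) unfold_locales

lemma cls_closed: "w \<in> lists (letters \<G>) \<Longrightarrow> cls w \<in> carrier P"
  by (auto simp: fundamental_group_def intro: quotientI simp del: in_lists_conv_set)

lemma cls_cases:
  assumes "p \<in> carrier P" obtains w where "w \<in> lists (letters \<G>)" "p = cls w"
  using assms by (auto simp: fundamental_group_def quotient_def simp del: in_lists_conv_set)

lemma one_eq_cls: "\<one>\<^bsub>P\<^esub> = cls []"
  by (simp add: fundamental_group_def)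

lemma cls_eq_iff:
  assumes "u \<in> lists (letters \<G>)" "w \<in> lists (letters \<G>)"
  shows "cls u = cls w \<longleftrightarrow> (u, w) \<in> word_rel \<G> E"
  using equiv_words assms by (rule eq_equiv_class_iff)

lemma cls_eqI: "(u, w) \<in> word_rel \<G> E \<Longrightarrow> cls u = cls w"
  by (rule equiv_class_eq[OF equiv_words])

lemma cls_append:
  assumes "u \<in> lists (letters \<G>)" "w \<in> lists (letters \<G>)"
  shows "cls u \<otimes>\<^bsub>P\<^esub> cls w = cls (u @ w)"
  unfolding fundamental_group_def monoid.simps
  by (rule UN_equiv_class2[OF equiv_words equiv_words _ assms, of "\<lambda>u w. cls (u @ w)"])
    (auto simp: congruent2_def intro!: cls_eqI word_rel.append)

section \<open>Generators of the fundamental group and their relations\<close>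

lemma Elem_letter: "v \<in> verts (base \<G>) \<Longrightarrow> g \<in> carrier (vgrp \<G> v) \<Longrightarrow> Elem v g \<in> letters \<G>"
  by (simp add: letters_def)

lemma Arc_letter: "a \<in> arcs (base \<G>) \<Longrightarrow> Arc a \<in> letters \<G>"
  by (simp add: letters_def)

lemma incl_hom:
  assumes "a \<in> arcs (base \<G>)"
  shows "group_hom (agrp \<G> a) (vgrp \<G> (head (base \<G>) a)) (incl \<G> a)"
  using incl_mon[OF assms] group_agrp[OF assms] group_vgrp[OF base.head_closed[OF assms]]
  by (simp add: group_hom_def group_hom_axioms_def mon_def)

lemma incl_closed:
  assumes "a \<in> arcs (base \<G>)" "h \<in> carrier (agrp \<G> a)"
  shows "incl \<G> a h \<in> carrier (vgrp \<G> (head (base \<G>) a))"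
  using group_hom.hom_closed[OF incl_hom] assms by blast

lemma incl_arev_closed:
  assumes "a \<in> arcs (base \<G>)" "h \<in> carrier (agrp \<G> a)"
  shows "incl \<G> (arev (base \<G>) a) h \<in> carrier (vgrp \<G> (tail (base \<G>) a))"
  using incl_closed[OF base.arev_in_arcs[OF assms(1)], of h] assms agrp_arev base.head_arev by simp

lemma gen_elem_hom:
  assumes v: "v \<in> verts (base \<G>)"
  shows "group_hom (vgrp \<G> v) P (gen_elem \<G> E v)"
proof -
  interpret G: group "vgrp \<G> v" using v by (rule group_vgrp)
  have "gen_elem \<G> E v \<in> hom (vgrp \<G> v) P"
  proof (rule homI)
    fix g assume "g \<in> carrier (vgrp \<G> v)"
    then show "gen_elem \<G> E v g \<in> carrier P"
      unfolding gen_elem_def by (intro cls_closed) (simp add: Elem_letter v)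
  next
    fix g k assume "g \<in> carrier (vgrp \<G> v)" "k \<in> carrier (vgrp \<G> v)"
    then show "gen_elem \<G> E v (g \<otimes>\<^bsub>vgrp \<G> v\<^esub> k) = gen_elem \<G> E v g \<otimes>\<^bsub>P\<^esub> gen_elem \<G> E v k"
      unfolding gen_elem_def
      by (subst cls_append) (auto simp: Elem_letter v intro!: cls_eqI word_rel.mult[THEN word_rel.sym])
  qed
  then show ?thesis
    by (simp add: group_hom_def group_hom_axioms_def G.group_axioms P.group_axioms)
qed

lemma gen_elem_closed:
  "v \<in> verts (base \<G>) \<Longrightarrow> g \<in> carrier (vgrp \<G> v) \<Longrightarrow> gen_elem \<G> E v g \<in> carrier P"
  by (rule group_hom.hom_closed[OF gen_elem_hom])

lemma gen_arc_closed: "a \<in> arcs (base \<G>) \<Longrightarrow> gen_arc \<G> E a \<in> carrier P"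
  unfolding gen_arc_def by (intro cls_closed) (simp add: Arc_letter)

lemma gen_arc_arev_r:
  assumes "a \<in> arcs (base \<G>)"
  shows "gen_arc \<G> E a \<otimes>\<^bsub>P\<^esub> gen_arc \<G> E (arev (base \<G>) a) = \<one>\<^bsub>P\<^esub>"
  unfolding gen_arc_def one_eq_cls using assms
  by (subst cls_append) (auto simp: Arc_letter base.arev_in_arcs intro!: cls_eqI word_rel.arev)

lemma gen_arc_arev:
  assumes "a \<in> arcs (base \<G>)"
  shows "gen_arc \<G> E (arev (base \<G>) a) = inv\<^bsub>P\<^esub> gen_arc \<G> E a"
  using gen_arc_arev_r[OF base.arev_in_arcs[OF assms]] assms
  by (intro P.inv_equality[symmetric])
    (simp_all add: base.arev_arev base.arev_in_arcs gen_arc_closed)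

text \<open>The conjugation relation rewritten so that an element of the arc group passes across the
  generator \<open>a\<close>, which is the form that coordinates need.\<close>

lemma gen_arc_conj:
  assumes a: "a \<in> arcs (base \<G>)" and h: "h \<in> carrier (agrp \<G> a)"
  shows "gen_arc \<G> E a \<otimes>\<^bsub>P\<^esub> gen_elem \<G> E (head (base \<G>) a) (incl \<G> a h) =
    gen_elem \<G> E (tail (base \<G>) a) (incl \<G> (arev (base \<G>) a) h) \<otimes>\<^bsub>P\<^esub> gen_arc \<G> E a"
proof -
  let ?b = "arev (base \<G>) a"
  let ?x = "gen_elem \<G> E (head (base \<G>) a) (incl \<G> a h)"
  have L: "Arc a \<in> letters \<G>" "Elem (head (base \<G>) a) (incl \<G> a h) \<in> letters \<G>"
      "Arc ?b \<in> letters \<G>"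
    using a h by (simp_all add: Arc_letter Elem_letter base.arev_in_arcs base.head_closed incl_closed)
  have x: "?x \<in> carrier P"
    using a h by (simp add: gen_elem_closed base.head_closed incl_closed)
  have "gen_arc \<G> E a \<otimes>\<^bsub>P\<^esub> ?x \<otimes>\<^bsub>P\<^esub> gen_arc \<G> E ?b =
      gen_elem \<G> E (tail (base \<G>) a) (incl \<G> ?b h)"
    unfolding gen_arc_def gen_elem_def using L
    by (simp add: cls_append) (intro cls_eqI word_rel.conj a h)
  then have "gen_elem \<G> E (tail (base \<G>) a) (incl \<G> ?b h) \<otimes>\<^bsub>P\<^esub> gen_arc \<G> E a =
      gen_arc \<G> E a \<otimes>\<^bsub>P\<^esub> ?x \<otimes>\<^bsub>P\<^esub> inv\<^bsub>P\<^esub> gen_arc \<G> E a \<otimes>\<^bsub>P\<^esub> gen_arc \<G> E a"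
    using a by (simp add: gen_arc_arev)
  then show ?thesis
    using a x gen_arc_closed[OF a] by (simp add: P.m_assoc)
qed

lemma gen_arc_tree: "a \<in> E \<Longrightarrow> a \<in> arcs (base \<G>) \<Longrightarrow> gen_arc \<G> E a = \<one>\<^bsub>P\<^esub>"
  unfolding gen_arc_def one_eq_cls by (intro cls_eqI word_rel.tree) simp

text \<open>Words are built up at their right end, because moves in the scaffolding change
  coordinates on the right. Inverses need no case of their own: the generating set is closed under
  them.\<close>

lemma generated_induct [consumes 1, case_names one elem arc]:
  assumes "p \<in> carrier P" "Q \<one>\<^bsub>P\<^esub>"
    and "\<And>p v g. \<lbrakk>p \<in> carrier P; Q p; v \<in> verts (base \<G>); g \<in> carrier (vgrp \<G> v)\<rbrakk> \<Longrightarrow>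
      Q (p \<otimes>\<^bsub>P\<^esub> gen_elem \<G> E v g)"
    and "\<And>p a. \<lbrakk>p \<in> carrier P; Q p; a \<in> arcs (base \<G>)\<rbrakk> \<Longrightarrow> Q (p \<otimes>\<^bsub>P\<^esub> gen_arc \<G> E a)"
  shows "Q p"
proof -
  have "Q (cls w)" if "w \<in> lists (letters \<G>)" for w
    using that
  proof (induction w rule: rev_induct)
    case Nil
    then show ?case using assms(2) by (simp add: one_eq_cls)
  next
    case (snoc l w)
    then have w: "w \<in> lists (letters \<G>)" and l: "l \<in> letters \<G>" by auto
    have "cls (w @ [l]) = cls w \<otimes>\<^bsub>P\<^esub> cls [l]" using w l by (simp add: cls_append)
    moreover have "Q (cls w \<otimes>\<^bsub>P\<^esub> cls [l])"
      using l assms(3)[OF cls_closed[OF w] snoc.IH[OF w]] assms(4)[OF cls_closed[OF w] snoc.IH[OF w]]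
      by (cases l) (auto simp: letters_def gen_elem_def gen_arc_def)
    ultimately show ?case by simp
  qed
  then show ?thesis using assms(1) cls_cases by metis
qed

end

section \<open>Scaffoldings as coverings of the base graph\<close>

lemma regular_actions_simps [simp]:
  "base (regular_actions \<G>) = base \<G>" "vgrp (regular_actions \<G>) = vgrp \<G>"
  "agrp (regular_actions \<G>) = agrp \<G>" "vset (regular_actions \<G>) v = carrier (vgrp \<G> v)"
  "vact (regular_actions \<G>) v = left_regular (vgrp \<G> v)"
  "aset (regular_actions \<G>) a = carrier (agrp \<G> a)"
  "emb (regular_actions \<G>) = incl \<G>"
  by (simp_all add: regular_actions_def)

locale regular_scaffolding =
  presented_group \<G> E + scaf: scaffolding "regular_actions \<G>" S
  for \<G> :: "('v, 'a, 'g, 'h) gog" and E :: "'a set"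
    and S :: "('v, 'a, 'g, 'h, 's, 'b) scaffold"
begin

abbreviation "V \<equiv> verts (sgraph S)"
abbreviation "B \<equiv> arcs (sgraph S)"
abbreviation "src \<equiv> tail (sgraph S)"
abbreviation "dst \<equiv> head (sgraph S)"
abbreviation "bar \<equiv> arev (sgraph S)"
abbreviation "brel \<equiv> arc_rel (sgraph S) (srel S)"
abbreviation "rv \<equiv> arev (base \<G>)"
abbreviation "org \<equiv> tail (base \<G>)"
abbreviation "trm \<equiv> head (base \<G>)"

definition over :: "'s \<Rightarrow> 'v" where "over x = vproj S (srel S `` {x})"
definition aover :: "'b \<Rightarrow> 'a" where "aover b = aproj S (brel `` {b})"

section \<open>The equivalence relations and the quotient tree\<close>

sublocale tree: rtree "stree S"
  by (rule scaf.rtree_stree)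

lemmas srel_class_eq = equiv_class_eq[OF scaf.equiv_srel]

lemma srel_V: "(x, y) \<in> srel S \<Longrightarrow> x \<in> V \<and> y \<in> V"
  using scaf.equiv_srel by (auto simp: equiv_def refl_on_def)

lemma srel_refl: "x \<in> V \<Longrightarrow> (x, x) \<in> srel S"
  using scaf.equiv_srel by (auto simp: equiv_def refl_on_def)

lemma srel_sym: "(x, y) \<in> srel S \<Longrightarrow> (y, x) \<in> srel S"
  using scaf.equiv_srel by (auto simp: equiv_def dest: symD)

lemma srel_trans: "(x, y) \<in> srel S \<Longrightarrow> (y, z) \<in> srel S \<Longrightarrow> (x, z) \<in> srel S"
  using scaf.equiv_srel by (auto simp: equiv_def dest: transD)

lemma equiv_brel: "equiv B brel"
proof (rule equivI)
  show "brel \<subseteq> B \<times> B" by (auto simp: arc_rel_def)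
  show "refl_on B brel"
    by (auto simp: refl_on_def arc_rel_def srel_refl scaf.tail_closed scaf.head_closed)
  show "sym brel" by (rule symI) (simp add: arc_rel_def, meson srel_sym)
  show "trans brel"
    by (rule transI) (clarsimp simp: arc_rel_def, meson srel_trans)
qed

lemmas brel_class_eq = equiv_class_eq[OF equiv_brel]

lemma brel_B: "(b, c) \<in> brel \<Longrightarrow> b \<in> B \<and> c \<in> B"
  by (auto simp: arc_rel_def)

lemma brel_refl: "b \<in> B \<Longrightarrow> (b, b) \<in> brel"
  using equiv_brel by (auto simp: equiv_def refl_on_def)

lemma brel_rev: "(b, c) \<in> brel \<Longrightarrow> (bar b, bar c) \<in> brel"
  by (auto simp: arc_rel_def scaf.arev_in_arcs scaf.tail_arev scaf.head_arev)

lemma verts_stree: "verts (stree S) = V // srel S"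
  by (simp add: stree_def quotient_graph_def)

lemma arcs_stree: "arcs (stree S) = B // brel"
  by (simp add: stree_def quotient_graph_def)

lemma class_in_stree: "x \<in> V \<Longrightarrow> srel S `` {x} \<in> verts (stree S)"
  by (auto simp: verts_stree intro: quotientI)

lemma arc_class_in_stree: "b \<in> B \<Longrightarrow> brel `` {b} \<in> arcs (stree S)"
  by (auto simp: arcs_stree intro: quotientI)

lemma tail_stree: "b \<in> B \<Longrightarrow> tail (stree S) (brel `` {b}) = srel S `` {src b}"
  unfolding stree_def quotient_graph_def
  by (simp, rule UN_equiv_class[OF equiv_brel, of "\<lambda>c. srel S `` {src c}"])
    (auto simp: congruent_def arc_rel_def simp del: Image_singleton_iff dest: srel_class_eq)

lemma head_stree: "b \<in> B \<Longrightarrow> head (stree S) (brel `` {b}) = srel S `` {dst b}"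
  unfolding stree_def quotient_graph_def
  by (simp, rule UN_equiv_class[OF equiv_brel, of "\<lambda>c. srel S `` {dst c}"])
    (auto simp: congruent_def arc_rel_def simp del: Image_singleton_iff dest: srel_class_eq)

lemma arev_stree: "b \<in> B \<Longrightarrow> arev (stree S) (brel `` {b}) = brel `` {bar b}"
proof -
  assume b: "b \<in> B"
  have "c \<in> bar ` (brel `` {b})" if "(bar b, c) \<in> brel" for c
    using brel_rev[OF that] b brel_B[OF that] scaf.arev_arev by (intro image_eqI[of _ _ "bar c"]) auto
  then show ?thesis by (auto simp: stree_def quotient_graph_def intro: brel_rev)
qed

lemma over_closed: "x \<in> V \<Longrightarrow> over x \<in> verts (base \<G>)"
  using scaf.proj_hom class_in_stree by (auto simp: rgraph_hom_def over_def Pi_iff)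

lemma aover_closed: "b \<in> B \<Longrightarrow> aover b \<in> arcs (base \<G>)"
  using scaf.proj_hom arc_class_in_stree by (auto simp: rgraph_hom_def aover_def Pi_iff)

lemma over_src: "b \<in> B \<Longrightarrow> over (src b) = org (aover b)"
  using scaf.proj_hom arc_class_in_stree[of b] by (auto simp: rgraph_hom_def aover_def over_def tail_stree)

lemma over_dst: "b \<in> B \<Longrightarrow> over (dst b) = trm (aover b)"
  using scaf.proj_hom arc_class_in_stree[of b] by (auto simp: rgraph_hom_def aover_def over_def head_stree)

lemma aover_rev: "b \<in> B \<Longrightarrow> aover (bar b) = rv (aover b)"
  using scaf.proj_hom arc_class_in_stree[of b] by (auto simp: rgraph_hom_def aover_def arev_stree)

lemma over_cong: "(x, y) \<in> srel S \<Longrightarrow> over x = over y"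
  by (simp add: over_def srel_class_eq)

lemma aover_cong: "(b, c) \<in> brel \<Longrightarrow> aover b = aover c"
  by (simp add: aover_def brel_class_eq)

section \<open>Colours within a class\<close>

lemma vcol_bij_class: "x \<in> V \<Longrightarrow> bij_betw (vcol S) (srel S `` {x}) (carrier (vgrp \<G> (over x)))"
  using scaf.vcol_bij[OF class_in_stree] by (simp add: over_def)

lemma acol_bij_class: "b \<in> B \<Longrightarrow> bij_betw (acol S) (brel `` {b}) (carrier (agrp \<G> (aover b)))"
  using scaf.acol_bij[OF arc_class_in_stree] by (simp add: aover_def)

lemma vcol_closed: "x \<in> V \<Longrightarrow> vcol S x \<in> carrier (vgrp \<G> (over x))"
  using bij_betwE[OF vcol_bij_class] srel_refl by auto

lemma acol_closed: "b \<in> B \<Longrightarrow> acol S b \<in> carrier (agrp \<G> (aover b))"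
  using bij_betwE[OF acol_bij_class] brel_refl by auto

lemma vcol_inject:
  assumes "(x, y) \<in> srel S" "vcol S x = vcol S y"
  shows "x = y"
proof -
  have x: "x \<in> V" using assms(1) srel_V by blast
  show ?thesis
    by (rule inj_onD[OF bij_betw_imp_inj_on[OF vcol_bij_class[OF x]] assms(2)])
      (simp_all add: srel_refl x assms(1))
qed

lemma acol_inject:
  assumes "(b, c) \<in> brel" "acol S b = acol S c"
  shows "b = c"
proof -
  have b: "b \<in> B" using assms(1) brel_B by blast
  show ?thesis
    by (rule inj_onD[OF bij_betw_imp_inj_on[OF acol_bij_class[OF b]] assms(2)])
      (simp_all add: brel_refl b assms(1))
qed

lemma ex_vcol:
  assumes "x \<in> V" "g \<in> carrier (vgrp \<G> (over x))"
  shows "\<exists>y. (x, y) \<in> srel S \<and> vcol S y = g"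
proof -
  have "g \<in> vcol S ` (srel S `` {x})"
    using assms by (simp add: bij_betw_imp_surj_on[OF vcol_bij_class])
  then show ?thesis by blast
qed

lemma ex_acol:
  assumes "b \<in> B" "h \<in> carrier (agrp \<G> (aover b))"
  shows "\<exists>c. (b, c) \<in> brel \<and> acol S c = h"
proof -
  have "h \<in> acol S ` (brel `` {b})"
    using assms by (simp add: bij_betw_imp_surj_on[OF acol_bij_class])
  then show ?thesis by blast
qed

lemma col_map_class:
  assumes "(b, c) \<in> brel"
  shows "col_map S (brel `` {b}) (acol S c) = vcol S (dst c)"
  unfolding col_map_def
  by (subst inv_into_f_f[OF bij_betw_imp_inj_on[OF acol_bij_class[of b]]])
    (use assms brel_B[OF assms] in simp_all)

text \<open>For the regular action the adhesion condition becomes a formula: the terminus colours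
  along one arc class are a left translate of the image of the arc group, by a \<open>g\<close>
  shared by the entire class.\<close>

lemma dst_colour:
  assumes b: "b \<in> B"
  obtains g where "g \<in> carrier (vgrp \<G> (over (dst b)))"
    "\<And>c. (b, c) \<in> brel \<Longrightarrow> vcol S (dst c) = g \<otimes>\<^bsub>vgrp \<G> (over (dst b))\<^esub> incl \<G> (aover b) (acol S c)"
proof -
  from scaf.col_map_adhesion[OF arc_class_in_stree[OF b]]
  obtain g where g: "g \<in> carrier (vgrp \<G> (over (dst b)))"
    and *: "\<forall>y\<in>carrier (agrp \<G> (aover b)). col_map S (brel `` {b}) y =
      left_regular (vgrp \<G> (over (dst b))) g (incl \<G> (aover b) y)"
    unfolding adhesion_map_def by (auto simp: over_dst[OF b] simp flip: aover_def)
  have "vcol S (dst c) = g \<otimes>\<^bsub>vgrp \<G> (over (dst b))\<^esub> incl \<G> (aover b) (acol S c)"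
    if c: "(b, c) \<in> brel" for c
  proof -
    have h: "acol S c \<in> carrier (agrp \<G> (aover b))"
      using acol_closed brel_B[OF c] aover_cong[OF c] by auto
    then have "incl \<G> (aover b) (acol S c) \<in> carrier (vgrp \<G> (over (dst b)))"
      using incl_closed[OF aover_closed[OF b]] by (simp add: over_dst[OF b])
    then show ?thesis using * h col_map_class[OF c] by (simp add: left_regular_def)
  qed
  with g show ?thesis by (rule that)
qed

text \<open>Two values of one adhesion map differ by the image of the quotient of the arguments,
  since the unknown translation \<open>g\<close> cancels. This describes the termini of a class
  relative to any one of its arcs.\<close>

lemma dst_colour_diff:
  assumes c: "(b, c) \<in> brel"
  shows "vcol S (dst c) = vcol S (dst b) \<otimes>\<^bsub>vgrp \<G> (over (dst b))\<^esub>
    incl \<G> (aover b) (inv\<^bsub>agrp \<G> (aover b)\<^esub> acol S b \<otimes>\<^bsub>agrp \<G> (aover b)\<^esub> acol S c)"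
proof -
  have b: "b \<in> B" using c brel_B by blast
  interpret group_hom "agrp \<G> (aover b)" "vgrp \<G> (over (dst b))" "incl \<G> (aover b)"
    using incl_hom[OF aover_closed[OF b]] by (simp add: over_dst[OF b])
  obtain g where g: "g \<in> carrier (vgrp \<G> (over (dst b)))"
    and *: "\<And>c. (b, c) \<in> brel \<Longrightarrow>
      vcol S (dst c) = g \<otimes>\<^bsub>vgrp \<G> (over (dst b))\<^esub> incl \<G> (aover b) (acol S c)"
    using dst_colour[OF b] by blast
  have h: "acol S b \<in> carrier (agrp \<G> (aover b))" "acol S c \<in> carrier (agrp \<G> (aover b))"
    using acol_closed[OF b] acol_closed[of c] brel_B[OF c] aover_cong[OF c] by auto
  show ?thesis
    using *[OF c] *[OF brel_refl[OF b]] g h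
    by (simp only: shift_left_factor)
qed

text \<open>The formula for termini applied to the reversed arcs, which carry the same colours. Thus
  one element of the arc group governs both ends.\<close>

lemma src_colour_diff:
  assumes c: "(b, c) \<in> brel"
  shows "vcol S (src c) = vcol S (src b) \<otimes>\<^bsub>vgrp \<G> (over (src b))\<^esub>
    incl \<G> (rv (aover b)) (inv\<^bsub>agrp \<G> (aover b)\<^esub> acol S b \<otimes>\<^bsub>agrp \<G> (aover b)\<^esub> acol S c)"
  using dst_colour_diff[OF brel_rev[OF c]] brel_B[OF c]
  by (simp add: scaf.head_arev aover_rev scaf.acol_arev agrp_arev aover_closed)

text \<open>With \<open>dst b\<close> as coset representative, the adhesion set of a class is seen
  to depend only on that vertex and on \<open>aover b\<close>; this is what the uniqueness clause
  for arcs of the tree is matched against.\<close>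

lemma col_map_image:
  assumes b: "b \<in> B"
  shows "col_map S (brel `` {b}) ` carrier (agrp \<G> (aover b)) =
    (\<lambda>h. vcol S (dst b) \<otimes>\<^bsub>vgrp \<G> (over (dst b))\<^esub> incl \<G> (aover b) h) ` carrier (agrp \<G> (aover b))"
    (is "?f ` ?H = ?k ` ?H")
proof -
  interpret H: group "agrp \<G> (aover b)" using aover_closed[OF b] by (rule group_agrp)
  let ?d = "\<lambda>h. inv\<^bsub>agrp \<G> (aover b)\<^esub> acol S b \<otimes>\<^bsub>agrp \<G> (aover b)\<^esub> h"
  have k: "acol S b \<in> ?H" by (rule acol_closed[OF b])
  have f: "?f h = ?k (?d h)" if h: "h \<in> ?H" for h
  proof -
    obtain c where c: "(b, c) \<in> brel" "acol S c = h" using ex_acol[OF b h] by blast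
    show ?thesis using col_map_class[OF c(1)] dst_colour_diff[OF c(1)] c(2) by simp
  qed
  \<comment> \<open>Left multiplication by the inverse of \<open>acol S b\<close> permutes the arc
    group, so the base arc \<open>b\<close> only reparametrises the coset.\<close>
  have "?d ` ?H = ?H"
  proof
    show "?H \<subseteq> ?d ` ?H"
    proof
      fix h assume h: "h \<in> ?H"
      then have "h = ?d (acol S b \<otimes>\<^bsub>agrp \<G> (aover b)\<^esub> h)" using k by simp
      then show "h \<in> ?d ` ?H" by (rule image_eqI) (simp add: h k)
    qed
  qed (use k in auto)
  then show ?thesis using f by (metis (no_types, lifting) image_cong image_image)
qed

section \<open>Unique lifting of arcs\<close>

lemma adhesion_set_coset:
  assumes a: "a \<in> arcs (base \<G>)" and g: "g \<in> carrier (vgrp \<G> (trm a))"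
  shows "adhesion_set (regular_actions \<G>) a
    ((\<lambda>h. g \<otimes>\<^bsub>vgrp \<G> (trm a)\<^esub> incl \<G> a h) ` carrier (agrp \<G> a))"
  unfolding adhesion_set_def adhesion_map_def
  by (rule exI[of _ "\<lambda>h. g \<otimes>\<^bsub>vgrp \<G> (trm a)\<^esub> incl \<G> a h"])
    (use g in \<open>auto simp: left_regular_def incl_closed[OF a] intro!: bexI[of _ g]\<close>)

text \<open>Two such arcs have the same adhesion set, the coset through the colour of their common
  terminus, so the uniqueness clause puts them in one class. Inside a class the terminus colour
  determines the arc colour because \<open>incl\<close> is injective.\<close>

lemma arc_in_unique:
  assumes b: "b \<in> B" and c: "c \<in> B" and d: "dst b = dst c" and a: "aover b = aover c"
  shows "b = c"
proof -
  let ?x = "dst b" and ?a = "aover b"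
  interpret group_hom "agrp \<G> ?a" "vgrp \<G> (over ?x)" "incl \<G> ?a"
    using incl_hom[OF aover_closed[OF b]] by (simp add: over_dst[OF b])
  let ?Z = "(\<lambda>h. vcol S ?x \<otimes>\<^bsub>vgrp \<G> (over ?x)\<^esub> incl \<G> ?a h) ` carrier (agrp \<G> ?a)"
  have x: "?x \<in> V" by (rule scaf.head_closed[OF b])
  have vx: "vcol S ?x \<in> carrier (vgrp \<G> (over ?x))" by (rule vcol_closed[OF x])
  have "adhesion_set (regular_actions \<G>) ?a ?Z"
    using adhesion_set_coset[OF aover_closed[OF b], of "vcol S ?x"] vx over_dst[OF b] by simp
  from scaf.unique_arc[OF class_in_stree[OF x] _ _ this]
  have ex1: "\<exists>!D. D \<in> arcs (stree S) \<and> head (stree S) D = srel S `` {?x} \<and> aproj S D = ?a \<and>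
      col_map S D ` carrier (agrp \<G> ?a) = ?Z"
    using aover_closed[OF b] over_dst[OF b] by (simp add: over_def)
  have "brel `` {b} = brel `` {c}"
  proof (rule ex1E[OF ex1])
    fix D assume D: "\<forall>D'. D' \<in> arcs (stree S) \<and> head (stree S) D' = srel S `` {?x} \<and>
      aproj S D' = ?a \<and> col_map S D' ` carrier (agrp \<G> ?a) = ?Z \<longrightarrow> D' = D"
    have "brel `` {b} = D"
      using D arc_class_in_stree[OF b] head_stree[OF b] col_map_image[OF b] by (simp add: aover_def)
    moreover have "brel `` {c} = D"
      using D arc_class_in_stree[OF c] head_stree[OF c] col_map_image[OF c] a d by (simp add: aover_def)
    ultimately show ?thesis by simp
  qed
  then have bc: "(b, c) \<in> brel" using c brel_refl[of c] by blast
  have k: "acol S b \<in> carrier (agrp \<G> ?a)" "acol S c \<in> carrier (agrp \<G> ?a)"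
    using acol_closed[OF b] acol_closed[OF c] a by auto
  let ?h = "inv\<^bsub>agrp \<G> ?a\<^esub> acol S b \<otimes>\<^bsub>agrp \<G> ?a\<^esub> acol S c"
  have h: "?h \<in> carrier (agrp \<G> ?a)" using k by simp
  have "vcol S ?x = vcol S ?x \<otimes>\<^bsub>vgrp \<G> (over ?x)\<^esub> incl \<G> ?a ?h"
    by (rule dst_colour_diff[OF bc, folded d])
  then have "incl \<G> ?a ?h = \<one>\<^bsub>vgrp \<G> (over ?x)\<^esub>"
    by (rule iffD1[OF H.l_cancel_one'[OF vx hom_closed[OF h]]])
  then have "incl \<G> ?a ?h = incl \<G> ?a \<one>\<^bsub>agrp \<G> ?a\<^esub>" by (simp only: hom_one)
  moreover have "inj_on (incl \<G> ?a) (carrier (agrp \<G> ?a))"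
    using incl_mon[OF aover_closed[OF b]] by (simp add: mon_def)
  ultimately have "?h = \<one>\<^bsub>agrp \<G> ?a\<^esub>"
    using h G.one_closed by (blast dest: inj_onD)
  then have "acol S b = acol S c" by (rule G.inv_mult_eq_oneD[OF k])
  then show "b = c" by (rule acol_inject[OF bc])
qed

text \<open>The required class is the one whose adhesion set is the coset through the colour of
  \<open>x\<close>. That set contains the colour of \<open>x\<close>, so some arc of the class ends
  at a vertex with the class and the colour of \<open>x\<close>, hence at \<open>x\<close>.\<close>

lemma ex_arc_in:
  assumes x: "x \<in> V" and a: "a \<in> arcs (base \<G>)" and ax: "trm a = over x"
  shows "\<exists>b. b \<in> B \<and> dst b = x \<and> aover b = a"
proof -
  interpret group_hom "agrp \<G> a" "vgrp \<G> (over x)" "incl \<G> a"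
    using incl_hom[OF a] by (simp add: ax)
  let ?Z = "(\<lambda>h. vcol S x \<otimes>\<^bsub>vgrp \<G> (over x)\<^esub> incl \<G> a h) ` carrier (agrp \<G> a)"
  have vx: "vcol S x \<in> carrier (vgrp \<G> (over x))" by (rule vcol_closed[OF x])
  have "adhesion_set (regular_actions \<G>) a ?Z"
    using adhesion_set_coset[OF a, of "vcol S x"] vx ax by simp
  from scaf.unique_arc[OF class_in_stree[OF x] _ _ this] obtain D where
    D: "D \<in> arcs (stree S)" "head (stree S) D = srel S `` {x}" "aproj S D = a"
      "col_map S D ` carrier (agrp \<G> a) = ?Z"
    using a ax by (auto simp: over_def)
  then obtain b where b: "b \<in> B" "D = brel `` {b}" by (auto simp: arcs_stree elim: quotientE)
  have ab: "aover b = a" using D b by (simp add: aover_def)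
  have "vcol S x \<in> ?Z"
    using vx by (intro image_eqI[of _ _ "\<one>\<^bsub>agrp \<G> a\<^esub>"]) auto
  then have "vcol S x \<in> col_map S D ` carrier (agrp \<G> a)" by (simp only: D(4))
  then obtain h where h: "h \<in> carrier (agrp \<G> a)" "vcol S x = col_map S D h" by blast
  then obtain c where c: "(b, c) \<in> brel" "acol S c = h" using ex_acol[OF b(1)] ab by blast
  have "vcol S (dst c) = vcol S x" using col_map_class[OF c(1)] c h b by simp
  moreover have "srel S `` {dst c} = srel S `` {x}"
    using D(2) b head_stree[of c] brel_class_eq[OF c(1)] brel_B[OF c(1)] by simp
  then have "(dst c, x) \<in> srel S" using srel_refl[OF x] by blast
  ultimately have "dst c = x" by (intro vcol_inject)
  then show ?thesis
    using brel_B[OF c(1)] aover_cong[OF c(1)] ab by auto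
qed

lemma arc_out_unique:
  assumes b: "b \<in> B" and c: "c \<in> B" and "src b = src c" "aover b = aover c"
  shows "b = c"
proof -
  have "bar b = bar c"
  proof (rule arc_in_unique)
    show "bar b \<in> B" "bar c \<in> B" by (rule scaf.arev_in_arcs[OF b], rule scaf.arev_in_arcs[OF c])
    show "dst (bar b) = dst (bar c)" by (simp only: scaf.head_arev b c assms(3))
    show "aover (bar b) = aover (bar c)" by (simp only: aover_rev b c assms(4))
  qed
  then show ?thesis by (metis scaf.arev_arev b c)
qed

lemma ex_arc_out:
  assumes x: "x \<in> V" and a: "a \<in> arcs (base \<G>)" and ax: "org a = over x"
  shows "\<exists>b. b \<in> B \<and> src b = x \<and> aover b = a"
proof -
  obtain b where b: "b \<in> B" "dst b = x" "aover b = rv a"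
    using ex_arc_in[OF x base.arev_in_arcs[OF a]] base.head_arev[OF a] ax by auto
  then show ?thesis
    using a by (intro exI[of _ "bar b"])
      (simp add: scaf.arev_in_arcs scaf.tail_arev aover_rev base.arev_arev)
qed

section \<open>Coordinates in the fundamental group\<close>

text \<open>The element by which \<open>y\<close> has to differ from \<open>x\<close> in coordinates when both lie in one class.\<close>

definition diff :: "'s \<Rightarrow> 's \<Rightarrow> ('v, 'a, 'g) letter list set" where
  "diff x y = gen_elem \<G> E (over x) (inv\<^bsub>vgrp \<G> (over x)\<^esub> vcol S x \<otimes>\<^bsub>vgrp \<G> (over x)\<^esub> vcol S y)"

lemma diff_eq_gen_elem:
  assumes x: "x \<in> V" and g: "g \<in> carrier (vgrp \<G> (over x))"
    and y: "vcol S y = vcol S x \<otimes>\<^bsub>vgrp \<G> (over x)\<^esub> g"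
  shows "diff x y = gen_elem \<G> E (over x) g"
proof -
  interpret G: group "vgrp \<G> (over x)" using over_closed[OF x] by (rule group_vgrp)
  show ?thesis by (simp add: diff_def y vcol_closed[OF x] g)
qed

lemma diff_closed:
  assumes xy: "(x, y) \<in> srel S"
  shows "diff x y \<in> carrier P"
proof -
  have x: "x \<in> V" and y: "y \<in> V" using srel_V[OF xy] by auto
  interpret G: group "vgrp \<G> (over x)" using over_closed[OF x] by (rule group_vgrp)
  show ?thesis
    unfolding diff_def
    by (intro gen_elem_closed over_closed x G.m_closed G.inv_closed vcol_closed
        vcol_closed[OF y, folded over_cong[OF xy]])
qed

lemma diff_trans:
  assumes xy: "(x, y) \<in> srel S" and yz: "(y, z) \<in> srel S"
  shows "diff x y \<otimes>\<^bsub>P\<^esub> diff y z = diff x z"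
proof -
  have V: "x \<in> V" "y \<in> V" "z \<in> V" using srel_V xy yz by blast+
  interpret group_hom "vgrp \<G> (over x)" P "gen_elem \<G> E (over x)"
    using over_closed[OF V(1)] by (rule gen_elem_hom)
  have o: "over y = over x" "over z = over x" using over_cong[OF xy] over_cong[OF yz] by auto
  then have c: "vcol S x \<in> carrier (vgrp \<G> (over x))" "vcol S y \<in> carrier (vgrp \<G> (over x))"
    "vcol S z \<in> carrier (vgrp \<G> (over x))"
    using vcol_closed V by metis+
  have "(inv\<^bsub>vgrp \<G> (over x)\<^esub> vcol S x \<otimes>\<^bsub>vgrp \<G> (over x)\<^esub> vcol S y) \<otimes>\<^bsub>vgrp \<G> (over x)\<^esub>
      (inv\<^bsub>vgrp \<G> (over x)\<^esub> vcol S y \<otimes>\<^bsub>vgrp \<G> (over x)\<^esub> vcol S z) =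
      inv\<^bsub>vgrp \<G> (over x)\<^esub> vcol S x \<otimes>\<^bsub>vgrp \<G> (over x)\<^esub> vcol S z"
    using c by (simp add: G.m_assoc)
  then show ?thesis
    unfolding diff_def o using c by (metis G.inv_closed G.m_closed hom_mult)
qed

lemma diff_refl:
  assumes "x \<in> V" shows "diff x x = \<one>\<^bsub>P\<^esub>"
proof -
  interpret group_hom "vgrp \<G> (over x)" P "gen_elem \<G> E (over x)"
    using over_closed[OF assms] by (rule gen_elem_hom)
  show ?thesis using vcol_closed[OF assms] by (simp add: diff_def)
qed

lemma diff_sym:
  assumes "(x, y) \<in> srel S" shows "diff y x = inv\<^bsub>P\<^esub> diff x y"
  using diff_trans[OF srel_sym[OF assms] assms] diff_closed[OF assms]
    diff_closed[OF srel_sym[OF assms]] diff_refl[of y] srel_V[OF assms]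
  by (intro P.inv_equality[symmetric]) auto

text \<open>Both differences come from one element \<open>?h\<close> of the arc group, embedded at
  the two ends of the arc, and \<open>gen_arc_conj\<close> moves it across the generator.\<close>

lemma diff_arc:
  assumes bc: "(b, c) \<in> brel"
  shows "gen_arc \<G> E (aover b) \<otimes>\<^bsub>P\<^esub> diff (dst b) (dst c) =
    diff (src b) (src c) \<otimes>\<^bsub>P\<^esub> gen_arc \<G> E (aover b)"
proof -
  have b: "b \<in> B" and c: "c \<in> B" using brel_B[OF bc] by auto
  let ?a = "aover b"
  let ?h = "inv\<^bsub>agrp \<G> ?a\<^esub> acol S b \<otimes>\<^bsub>agrp \<G> ?a\<^esub> acol S c"
  have a: "?a \<in> arcs (base \<G>)" by (rule aover_closed[OF b])
  interpret H: group "agrp \<G> ?a" using a by (rule group_agrp)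
  have h: "?h \<in> carrier (agrp \<G> ?a)"
    by (intro H.m_closed H.inv_closed acol_closed[OF b] acol_closed[OF c, folded aover_cong[OF bc]])
  have "diff (dst b) (dst c) = gen_elem \<G> E (trm ?a) (incl \<G> ?a ?h)"
    using diff_eq_gen_elem[OF scaf.head_closed[OF b] _ dst_colour_diff[OF bc]] incl_closed[OF a h]
    by (simp add: over_dst[OF b])
  moreover have "diff (src b) (src c) = gen_elem \<G> E (org ?a) (incl \<G> (rv ?a) ?h)"
    using diff_eq_gen_elem[OF scaf.tail_closed[OF b] _ src_colour_diff[OF bc]] incl_arev_closed[OF a h]
    by (simp add: over_src[OF b])
  ultimately show ?thesis using gen_arc_conj[OF a h] by simp
qed

section \<open>Transport between classes and the coordinate\<close>

definition rep :: "'c set \<Rightarrow> 'c" where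
  "rep C = (SOME x. x \<in> C)"

text \<open>Transport along an arc of the tree, measured between the chosen representatives of its end
  classes; by \<open>diff_arc\<close> it does not depend on the representative of the arc.\<close>

definition step :: "'b set \<Rightarrow> ('v, 'a, 'g) letter list set" where
  "step D = diff (rep (tail (stree S) D)) (src (rep D)) \<otimes>\<^bsub>P\<^esub> gen_arc \<G> E (aover (rep D)) \<otimes>\<^bsub>P\<^esub>
    diff (dst (rep D)) (rep (head (stree S) D))"

lemma rep_srel: "x \<in> V \<Longrightarrow> (x, rep (srel S `` {x})) \<in> srel S"
  unfolding rep_def using someI[of "\<lambda>y. y \<in> srel S `` {x}" x] srel_refl by auto

lemma rep_brel: "b \<in> B \<Longrightarrow> (b, rep (brel `` {b})) \<in> brel"
  unfolding rep_def using someI[of "\<lambda>y. y \<in> brel `` {b}" b] brel_refl by auto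

text \<open>Replacing the chosen arc \<open>c\<close> by \<open>b\<close> inserts
  \<open>diff (src b) (src c)\<close> before the generator; \<open>diff_arc\<close> carries it
  across, where it merges with the last factor.\<close>

lemma step_class:
  assumes b: "b \<in> B"
  shows "step (brel `` {b}) = diff (rep (srel S `` {src b})) (src b) \<otimes>\<^bsub>P\<^esub> gen_arc \<G> E (aover b) \<otimes>\<^bsub>P\<^esub>
    diff (dst b) (rep (srel S `` {dst b}))"
proof -
  define c where "c = rep (brel `` {b})"
  let ?s = "rep (srel S `` {src b})" and ?t = "rep (srel S `` {dst b})"
  have bc: "(b, c) \<in> brel" unfolding c_def by (rule rep_brel[OF b])
  then have sc: "(src b, src c) \<in> srel S" and dc: "(dst b, dst c) \<in> srel S"
    by (auto simp: arc_rel_def)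
  have s: "(?s, src b) \<in> srel S" and t: "(dst b, ?t) \<in> srel S"
    using rep_srel scaf.tail_closed[OF b] scaf.head_closed[OF b] srel_sym by blast+
  have ct: "(dst c, ?t) \<in> srel S" by (rule srel_trans[OF srel_sym[OF dc] t])
  note cl = diff_closed[OF sc] diff_closed[OF dc] diff_closed[OF s] diff_closed[OF t]
    diff_closed[OF ct] gen_arc_closed[OF aover_closed[OF b]]
  have "step (brel `` {b}) = diff ?s (src c) \<otimes>\<^bsub>P\<^esub> gen_arc \<G> E (aover b) \<otimes>\<^bsub>P\<^esub> diff (dst c) ?t"
    unfolding step_def by (simp add: tail_stree[OF b] head_stree[OF b] aover_cong[OF bc] flip: c_def)
  also have "\<dots> = diff ?s (src b) \<otimes>\<^bsub>P\<^esub> (diff (src b) (src c) \<otimes>\<^bsub>P\<^esub> gen_arc \<G> E (aover b)) \<otimes>\<^bsub>P\<^esub> diff (dst c) ?t"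
    using cl by (simp add: P.m_assoc flip: diff_trans[OF s sc])
  also have "\<dots> = diff ?s (src b) \<otimes>\<^bsub>P\<^esub> gen_arc \<G> E (aover b) \<otimes>\<^bsub>P\<^esub> (diff (dst b) (dst c) \<otimes>\<^bsub>P\<^esub> diff (dst c) ?t)"
    using cl by (simp add: P.m_assoc flip: diff_arc[OF bc])
  finally show ?thesis by (simp only: diff_trans[OF dc ct])
qed

lemma step_closed: "D \<in> arcs (stree S) \<Longrightarrow> step D \<in> carrier P"
proof -
  assume "D \<in> arcs (stree S)"
  then obtain b where b: "b \<in> B" "D = brel `` {b}" by (auto simp: arcs_stree elim: quotientE)
  show ?thesis unfolding b(2) step_class[OF b(1)]
    using b(1) by (intro P.m_closed diff_closed gen_arc_closed aover_closed rep_srel srel_sym[OF rep_srel]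
        scaf.tail_closed scaf.head_closed)
qed

lemma step_arev:
  assumes "D \<in> arcs (stree S)"
  shows "step (arev (stree S) D) = inv\<^bsub>P\<^esub> step D"
proof -
  obtain b where b: "b \<in> B" "D = brel `` {b}" using assms by (auto simp: arcs_stree elim: quotientE)
  let ?s = "rep (srel S `` {src b})" and ?t = "rep (srel S `` {dst b})"
  have s: "(?s, src b) \<in> srel S" and t: "(dst b, ?t) \<in> srel S"
    using rep_srel scaf.tail_closed[OF b(1)] scaf.head_closed[OF b(1)] srel_sym by blast+
  note cl = diff_closed[OF s] diff_closed[OF t] gen_arc_closed[OF aover_closed[OF b(1)]]
  have "step (arev (stree S) D) = diff ?t (dst b) \<otimes>\<^bsub>P\<^esub> gen_arc \<G> E (rv (aover b)) \<otimes>\<^bsub>P\<^esub> diff (src b) ?s"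
    using step_class[OF scaf.arev_in_arcs[OF b(1)]]
    by (simp add: b arev_stree scaf.tail_arev scaf.head_arev aover_rev)
  also have "\<dots> = inv\<^bsub>P\<^esub> step D"
    using cl by (simp add: b step_class diff_sym[OF s] diff_sym[OF t] gen_arc_arev aover_closed
        P.inv_mult_group P.m_assoc)
  finally show ?thesis .
qed

text \<open>Transporting the unit out of a fixed class gives a value at every representative, and
  \<open>diff\<close> extends it to the rest of the class. The normalisation at one vertex is the
  starting point both for reaching every group element and for reading off the translation attached
  to an automorphism.\<close>

lemma ex_coord:
  "\<exists>f. (\<forall>x\<in>V. f x \<in> carrier P) \<and> (\<exists>x\<in>V. f x = \<one>\<^bsub>P\<^esub>) \<and>
    (\<forall>x y. (x, y) \<in> srel S \<longrightarrow> f y = f x \<otimes>\<^bsub>P\<^esub> diff x y) \<and>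
    (\<forall>b\<in>B. f (dst b) = f (src b) \<otimes>\<^bsub>P\<^esub> gen_arc \<G> E (aover b))"
proof -
  obtain \<tau> where \<tau>: "\<forall>u\<in>verts (stree S). \<forall>v\<in>verts (stree S). \<forall>s\<in>carrier P. \<tau> u v s \<in> carrier P"
    "\<forall>u\<in>verts (stree S). \<forall>s\<in>carrier P. \<tau> u u s = s"
    "\<forall>u\<in>verts (stree S). \<forall>v\<in>verts (stree S). \<forall>w\<in>verts (stree S). \<forall>s\<in>carrier P. \<tau> v w (\<tau> u v s) = \<tau> u w s"
    "\<forall>a\<in>arcs (stree S). \<forall>s\<in>carrier P. \<tau> (tail (stree S) a) (head (stree S) a) s = s \<otimes>\<^bsub>P\<^esub> step a"
    using tree.transport_exists[of "\<lambda>_. carrier P" "\<lambda>D p. p \<otimes>\<^bsub>P\<^esub> step D"]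
    by (simp add: step_closed step_arev P.m_assoc) blast
  obtain C where C: "C \<in> verts (stree S)" using tree.verts_nonempty by blast
  then obtain x0 where x0: "x0 \<in> V" "C = srel S `` {x0}" by (auto simp: verts_stree elim: quotientE)
  define f where "f x = \<tau> C (srel S `` {x}) \<one>\<^bsub>P\<^esub> \<otimes>\<^bsub>P\<^esub> diff (rep (srel S `` {x})) x" for x
  have \<tau>_closed: "\<tau> C (srel S `` {x}) \<one>\<^bsub>P\<^esub> \<in> carrier P" if "x \<in> V" for x
    using \<tau>(1) C class_in_stree[OF that] by simp
  have f_closed: "f x \<in> carrier P" if x: "x \<in> V" for x
    unfolding f_def using \<tau>_closed[OF x] diff_closed[OF srel_sym[OF rep_srel[OF x]]] by simp
  have f_srel: "f y = f x \<otimes>\<^bsub>P\<^esub> diff x y" if xy: "(x, y) \<in> srel S" for x y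
  proof -
    have x: "x \<in> V" using srel_V[OF xy] by blast
    have rx: "(rep (srel S `` {x}), x) \<in> srel S" by (rule srel_sym[OF rep_srel[OF x]])
    have "f y = \<tau> C (srel S `` {x}) \<one>\<^bsub>P\<^esub> \<otimes>\<^bsub>P\<^esub> (diff (rep (srel S `` {x})) x \<otimes>\<^bsub>P\<^esub> diff x y)"
      unfolding f_def diff_trans[OF rx xy] by (simp add: srel_class_eq[OF xy])
    then show ?thesis
      unfolding f_def using \<tau>_closed[OF x] diff_closed[OF rx] diff_closed[OF xy] by (simp add: P.m_assoc)
  qed
  have f_arc: "f (dst b) = f (src b) \<otimes>\<^bsub>P\<^esub> gen_arc \<G> E (aover b)" if b: "b \<in> B" for b
  proof -
    let ?s = "srel S `` {src b}" and ?t = "srel S `` {dst b}"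
    have st: "src b \<in> V" "dst b \<in> V" using b by (simp_all add: scaf.tail_closed scaf.head_closed)
    have s: "(rep ?s, src b) \<in> srel S" by (rule srel_sym[OF rep_srel[OF st(1)]])
    have t: "(dst b, rep ?t) \<in> srel S" by (rule rep_srel[OF st(2)])
    note cl = diff_closed[OF s] diff_closed[OF t] gen_arc_closed[OF aover_closed[OF b]] \<tau>_closed[OF st(1)]
    have "\<tau> C ?t \<one>\<^bsub>P\<^esub> = \<tau> ?s ?t (\<tau> C ?s \<one>\<^bsub>P\<^esub>)"
      using \<tau>(3) C class_in_stree st by simp
    also have "\<dots> = \<tau> C ?s \<one>\<^bsub>P\<^esub> \<otimes>\<^bsub>P\<^esub> step (brel `` {b})"
      using \<tau>(4) arc_class_in_stree[OF b] \<tau>_closed[OF st(1)] tail_stree[OF b] head_stree[OF b] by metis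
    \<comment> \<open>The last factor of \<open>step\<close> leads from \<open>dst b\<close> to the
      representative of its class and cancels against the correction that leads back.\<close>
    finally have "f (dst b) = \<tau> C ?s \<one>\<^bsub>P\<^esub> \<otimes>\<^bsub>P\<^esub> (diff (rep ?s) (src b) \<otimes>\<^bsub>P\<^esub> gen_arc \<G> E (aover b)) \<otimes>\<^bsub>P\<^esub>
        (diff (dst b) (rep ?t) \<otimes>\<^bsub>P\<^esub> inv\<^bsub>P\<^esub> diff (dst b) (rep ?t))"
      unfolding f_def step_class[OF b] diff_sym[OF t] using cl by (simp add: P.m_assoc)
    then show ?thesis
      unfolding f_def using cl by (simp add: P.m_assoc)
  qed
  have "f (rep C) = \<one>\<^bsub>P\<^esub>"
  proof -
    have "(x0, rep C) \<in> srel S" using rep_srel x0 by simp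
    then have "srel S `` {rep C} = C" "rep C \<in> V"
      using srel_class_eq srel_V x0(2) by blast+
    then show ?thesis unfolding f_def using \<tau>(2) C by (simp add: diff_refl)
  qed
  moreover have "rep C \<in> V" using rep_srel x0 srel_V by blast
  ultimately show ?thesis
    using f_closed f_srel f_arc by (intro exI[of _ f]) blast
qed

text \<open>The potential \<open>coord\<close> trivialises the transport; it exists because the tree has no cycles.\<close>

definition coord :: "'s \<Rightarrow> ('v, 'a, 'g) letter list set" where
  "coord = (SOME f. (\<forall>x\<in>V. f x \<in> carrier P) \<and> (\<exists>x\<in>V. f x = \<one>\<^bsub>P\<^esub>) \<and>
    (\<forall>x y. (x, y) \<in> srel S \<longrightarrow> f y = f x \<otimes>\<^bsub>P\<^esub> diff x y) \<and>
    (\<forall>b\<in>B. f (dst b) = f (src b) \<otimes>\<^bsub>P\<^esub> gen_arc \<G> E (aover b)))"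

lemmas coord_spec = someI_ex[OF ex_coord, folded coord_def]

lemma coord_closed: "x \<in> V \<Longrightarrow> coord x \<in> carrier P"
  and coord_one: "\<exists>x\<in>V. coord x = \<one>\<^bsub>P\<^esub>"
  and coord_srel: "(x, y) \<in> srel S \<Longrightarrow> coord y = coord x \<otimes>\<^bsub>P\<^esub> diff x y"
  and coord_arc: "b \<in> B \<Longrightarrow> coord (dst b) = coord (src b) \<otimes>\<^bsub>P\<^esub> gen_arc \<G> E (aover b)"
  using coord_spec by blast+

text \<open>Crossing an arc of the spanning tree multiplies the coordinate by a trivial generator,
  so the lift of the spanning tree through \<open>x\<close> has constant coordinate and meets every
  fibre.\<close>

lemma coord_span_fibre:
  assumes x: "x \<in> V" and v: "v \<in> verts (base \<G>)"
  shows "\<exists>y\<in>V. coord y = coord x \<and> over y = v"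
proof (rule span.connected_induct[of "over x" v])
  show "over x \<in> verts (base \<G>\<lparr>arcs := E\<rparr>)" "v \<in> verts (base \<G>\<lparr>arcs := E\<rparr>)"
    using x v over_closed by simp_all
  show "\<exists>y\<in>V. coord y = coord x \<and> over y = over x" using x by blast
next
  fix a assume "a \<in> arcs (base \<G>\<lparr>arcs := E\<rparr>)"
    and "\<exists>y\<in>V. coord y = coord x \<and> over y = tail (base \<G>\<lparr>arcs := E\<rparr>) a"
  then obtain y where a: "a \<in> E" and y: "y \<in> V" "coord y = coord x" "over y = org a" by auto
  have a': "a \<in> arcs (base \<G>)" by (rule span_arcs[OF a])
  obtain b where b: "b \<in> B" "src b = y" "aover b = a" using ex_arc_out[OF y(1) a'] y(3) by auto
  have "coord (dst b) = coord x"
    using coord_arc[OF b(1)] b y gen_arc_tree[OF a a'] coord_closed[OF x] by simp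
  then show "\<exists>y\<in>V. coord y = coord x \<and> over y = head (base \<G>\<lparr>arcs := E\<rparr>) a"
    using b over_dst[OF b(1)] scaf.head_closed[OF b(1)] by auto
qed

text \<open>Right multiplication by a generator is a move within a class or along an arc. Since
  \<open>v\<close> varies in the induction, the vertex with coordinate \<open>p\<close> can be taken
  over the base vertex where the generator applies; afterwards \<open>coord_span_fibre\<close> leads
  to the desired fibre.\<close>

lemma coord_surj:
  assumes "p \<in> carrier P" "v \<in> verts (base \<G>)"
  shows "\<exists>x\<in>V. coord x = p \<and> over x = v"
  using assms
proof (induction p arbitrary: v rule: generated_induct)
  case one
  then show ?case using coord_one coord_span_fibre by metis
next
  case (elem p u g)
  then obtain x where x: "x \<in> V" "coord x = p" "over x = u" by blast
  interpret G: group "vgrp \<G> u" using elem by (intro group_vgrp)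
  have "vcol S x \<otimes>\<^bsub>vgrp \<G> u\<^esub> g \<in> carrier (vgrp \<G> (over x))"
    using vcol_closed[OF x(1)] x elem by simp
  then obtain y where y: "(x, y) \<in> srel S" "vcol S y = vcol S x \<otimes>\<^bsub>vgrp \<G> u\<^esub> g"
    using ex_vcol[OF x(1)] by blast
  have "coord y = p \<otimes>\<^bsub>P\<^esub> gen_elem \<G> E u g"
    using coord_srel[OF y(1)] diff_eq_gen_elem[OF x(1), of g y] x y elem by simp
  then show ?case using coord_span_fibre[of y v] srel_V[OF y(1)] elem by auto
next
  case (arc p a)
  then obtain x where x: "x \<in> V" "coord x = p" "over x = org a" using base.tail_closed by blast
  obtain b where b: "b \<in> B" "src b = x" "aover b = a" using ex_arc_out[OF x(1), of a] x(3) arc by auto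
  have "coord (dst b) = p \<otimes>\<^bsub>P\<^esub> gen_arc \<G> E a" using coord_arc[OF b(1)] b x by simp
  then show ?case using coord_span_fibre[of "dst b" v] scaf.head_closed[OF b(1)] arc by auto
qed

text \<open>Connectedness of the scaffolding when classes count as connected: the tree is connected,
  and \<open>Q\<close> is propagated as a property of entire classes.\<close>

lemma scaffold_induct:
  assumes x: "x \<in> V" and y: "y \<in> V" and "Q x"
    and rel: "\<And>x y. (x, y) \<in> srel S \<Longrightarrow> Q x \<Longrightarrow> Q y"
    and arc: "\<And>b. b \<in> B \<Longrightarrow> Q (src b) \<Longrightarrow> Q (dst b)"
  shows "Q y"
proof -
  have "\<forall>z\<in>srel S `` {y}. Q z"
  proof (rule tree.connected_induct[of "srel S `` {x}" "srel S `` {y}" "\<lambda>C. \<forall>z\<in>C. Q z"])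
    show "\<forall>z\<in>srel S `` {x}. Q z" using rel \<open>Q x\<close> by blast
  next
    fix D assume D: "D \<in> arcs (stree S)" and IH: "\<forall>z\<in>tail (stree S) D. Q z"
    obtain b where b: "b \<in> B" "D = brel `` {b}" using D by (auto simp: arcs_stree elim: quotientE)
    have "src b \<in> tail (stree S) D"
      unfolding b(2) tail_stree[OF b(1)] using srel_refl scaf.tail_closed[OF b(1)] by simp
    then have "Q (dst b)" using IH arc b(1) by blast
    then show "\<forall>z\<in>head (stree S) D. Q z"
      unfolding b(2) head_stree[OF b(1)] using rel by blast
  qed (rule class_in_stree[OF x], rule class_in_stree[OF y])
  then show ?thesis using srel_refl[OF y] by blast
qed

section \<open>The right action of words\<close>

definition shift :: "'g \<Rightarrow> 's \<Rightarrow> 's" where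
  "shift g x = (THE y. (x, y) \<in> srel S \<and> vcol S y = vcol S x \<otimes>\<^bsub>vgrp \<G> (over x)\<^esub> g)"

text \<open>The lift of an arc at \<open>x\<close> in the covering, followed to its terminus; the
  description is meaningful when \<open>x\<close> lies over the origin of \<open>a\<close>.\<close>

definition cross :: "'a \<Rightarrow> 's \<Rightarrow> 's" where
  "cross a x = dst (THE b. b \<in> B \<and> src b = x \<and> aover b = a)"

abbreviation fib :: "'v \<Rightarrow> 's set" where
  "fib v \<equiv> {x \<in> V. over x = v}"

lemma shift_eq:
  assumes xy: "(x, y) \<in> srel S" and "vcol S y = vcol S x \<otimes>\<^bsub>vgrp \<G> (over x)\<^esub> g"
  shows "shift g x = y"
  unfolding shift_def
proof (rule the_equality)
  fix z assume "(x, z) \<in> srel S \<and> vcol S z = vcol S x \<otimes>\<^bsub>vgrp \<G> (over x)\<^esub> g"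
  then show "z = y" using assms srel_trans[OF srel_sym xy, of z] by (intro vcol_inject) auto
qed (use assms in simp)

lemma shift:
  assumes "x \<in> fib v" "g \<in> carrier (vgrp \<G> v)"
  shows "(x, shift g x) \<in> srel S" "vcol S (shift g x) = vcol S x \<otimes>\<^bsub>vgrp \<G> v\<^esub> g" "shift g x \<in> fib v"
proof -
  interpret G: group "vgrp \<G> v" using assms over_closed by (auto intro: group_vgrp)
  obtain y where y: "(x, y) \<in> srel S" "vcol S y = vcol S x \<otimes>\<^bsub>vgrp \<G> v\<^esub> g"
    using ex_vcol[of x "vcol S x \<otimes>\<^bsub>vgrp \<G> v\<^esub> g"] vcol_closed[of x] assms by auto
  have "shift g x = y" using y assms by (intro shift_eq) auto
  then show "(x, shift g x) \<in> srel S" "vcol S (shift g x) = vcol S x \<otimes>\<^bsub>vgrp \<G> v\<^esub> g" "shift g x \<in> fib v"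
    using y srel_V[OF y(1)] over_cong[OF y(1)] assms by auto
qed

lemma cross_src:
  assumes b: "b \<in> B"
  shows "cross (aover b) (src b) = dst b"
proof -
  have "(THE c. c \<in> B \<and> src c = src b \<and> aover c = aover b) = b"
    by (rule the_equality) (use b arc_out_unique in blast)+
  then show ?thesis by (simp add: cross_def)
qed

lemma cross_closed:
  assumes "a \<in> arcs (base \<G>)" "x \<in> fib (org a)"
  shows "cross a x \<in> fib (trm a)"
proof -
  obtain b where b: "b \<in> B" "src b = x" "aover b = a" using ex_arc_out[of x a] assms by auto
  have "cross a x = dst b" using cross_src[OF b(1)] b by simp
  then show ?thesis using scaf.head_closed[OF b(1)] over_dst[OF b(1)] b by simp
qed

lemma cross_arev:
  assumes "a \<in> arcs (base \<G>)" "x \<in> fib (org a)"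
  shows "cross (rv a) (cross a x) = x"
proof -
  obtain b where b: "b \<in> B" "src b = x" "aover b = a" using ex_arc_out[of x a] assms by auto
  have "cross (rv a) (cross a x) = cross (aover (bar b)) (src (bar b))"
    using cross_src[OF b(1)] b by (simp add: aover_rev scaf.tail_arev)
  also have "\<dots> = x"
    unfolding cross_src[OF scaf.arev_in_arcs[OF b(1)]] by (simp add: scaf.head_arev b)
  finally show ?thesis .
qed

text \<open>The conjugation relation realised on vertices: moving the lift of \<open>a\<close> at
  \<open>x\<close> inside its class by \<open>h\<close> displaces both of its ends, each through its
  own embedding of the arc group.\<close>

lemma shift_cross:
  assumes a: "a \<in> arcs (base \<G>)" and h: "h \<in> carrier (agrp \<G> a)" and x: "x \<in> fib (org a)"
  shows "shift (incl \<G> a h) (cross a x) = cross a (shift (incl \<G> (rv a) h) x)"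
proof -
  interpret H: group "agrp \<G> a" using a by (rule group_agrp)
  obtain b where b: "b \<in> B" "src b = x" "aover b = a" using ex_arc_out[of x a] a x by auto
  have k: "acol S b \<in> carrier (agrp \<G> a)" using acol_closed[OF b(1)] b by simp
  obtain c where bc: "(b, c) \<in> brel" and c: "acol S c = acol S b \<otimes>\<^bsub>agrp \<G> a\<^esub> h"
    using ex_acol[OF b(1), of "acol S b \<otimes>\<^bsub>agrp \<G> a\<^esub> h"] b h k by auto
  have cB: "c \<in> B" "aover c = a" using brel_B[OF bc] aover_cong[OF bc] b by auto
  have "shift (incl \<G> a h) (dst b) = dst c"
    using bc dst_colour_diff[OF bc] b c h k by (intro shift_eq) (auto simp: arc_rel_def)
  moreover have "shift (incl \<G> (rv a) h) x = src c"
    using bc src_colour_diff[OF bc] b c h k by (intro shift_eq) (auto simp: arc_rel_def)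
  ultimately show ?thesis using cross_src[OF b(1)] cross_src[OF cB(1)] b cB by simp
qed

text \<open>Over the spanning tree the covering is trivial: the transition maps are the lifts of
  arcs, and lifting the reversed arc undoes them.\<close>

lemma ex_transport:
  "\<exists>\<tau>. (\<forall>u\<in>verts (base \<G>). \<forall>v\<in>verts (base \<G>). \<forall>x\<in>fib u. \<tau> u v x \<in> fib v) \<and>
    (\<forall>u\<in>verts (base \<G>). \<forall>x\<in>fib u. \<tau> u u x = x) \<and>
    (\<forall>u\<in>verts (base \<G>). \<forall>v\<in>verts (base \<G>). \<forall>w\<in>verts (base \<G>). \<forall>x\<in>fib u. \<tau> v w (\<tau> u v x) = \<tau> u w x) \<and>
    (\<forall>a\<in>E. \<forall>x\<in>fib (org a). \<tau> (org a) (trm a) x = cross a x)"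
  using span.transport_exists[of fib cross] cross_closed cross_arev span_arcs
  by (simp del: mem_Collect_eq)

text \<open>Transport between fibres along lifts of paths in the spanning tree.\<close>

definition tr :: "'v \<Rightarrow> 'v \<Rightarrow> 's \<Rightarrow> 's" where
  "tr = (SOME \<tau>. (\<forall>u\<in>verts (base \<G>). \<forall>v\<in>verts (base \<G>). \<forall>x\<in>fib u. \<tau> u v x \<in> fib v) \<and>
    (\<forall>u\<in>verts (base \<G>). \<forall>x\<in>fib u. \<tau> u u x = x) \<and>
    (\<forall>u\<in>verts (base \<G>). \<forall>v\<in>verts (base \<G>). \<forall>w\<in>verts (base \<G>). \<forall>x\<in>fib u. \<tau> v w (\<tau> u v x) = \<tau> u w x) \<and>
    (\<forall>a\<in>E. \<forall>x\<in>fib (org a). \<tau> (org a) (trm a) x = cross a x))"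

lemmas tr_spec = someI_ex[OF ex_transport, folded tr_def]

lemma tr_closed: "x \<in> fib u \<Longrightarrow> v \<in> verts (base \<G>) \<Longrightarrow> tr u v x \<in> fib v"
  and tr_self: "x \<in> fib u \<Longrightarrow> tr u u x = x"
  and tr_trans: "x \<in> fib u \<Longrightarrow> v \<in> verts (base \<G>) \<Longrightarrow> w \<in> verts (base \<G>) \<Longrightarrow>
    tr v w (tr u v x) = tr u w x"
  and tr_span: "a \<in> E \<Longrightarrow> x \<in> fib (org a) \<Longrightarrow> tr (org a) (trm a) x = cross a x"
  using tr_spec over_closed by blast+

text \<open>A letter acts on all vertices, whatever they lie over: move along the spanning tree to the
  fibre where the letter makes sense and move back afterwards. Letters of a word act from left to
  right.\<close>

fun act :: "('v, 'a, 'g) letter \<Rightarrow> 's \<Rightarrow> 's" where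
  "act (Elem v g) x = tr v (over x) (shift g (tr (over x) v x))"
| "act (Arc a) x = tr (trm a) (over x) (cross a (tr (over x) (org a) x))"

lemma act_closed:
  assumes "l \<in> letters \<G>" "x \<in> fib u"
  shows "act l x \<in> fib u"
proof -
  have u: "u \<in> verts (base \<G>)" using assms(2) over_closed by auto
  show ?thesis
  proof (cases l)
    case (Elem v g)
    then have v: "v \<in> verts (base \<G>)" "g \<in> carrier (vgrp \<G> v)" using assms(1) by (auto simp: letters_def)
    then show ?thesis
      using tr_closed[OF shift(3)[OF tr_closed[OF assms(2) v(1)] v(2)] u] Elem assms(2) by simp
  next
    case (Arc a)
    then have a: "a \<in> arcs (base \<G>)" using assms(1) by (auto simp: letters_def)
    then show ?thesis
      using tr_closed[OF cross_closed[OF a tr_closed[OF assms(2) base.tail_closed[OF a]]] u]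
        Arc assms(2) by simp
  qed
qed

section \<open>Compatibility of the action with the relations\<close>

lemma act_Elem: "x \<in> fib u \<Longrightarrow> act (Elem v g) x = tr v u (shift g (tr u v x))"
  and act_Arc: "x \<in> fib u \<Longrightarrow> act (Arc a) x = tr (trm a) u (cross a (tr u (org a) x))"
  by auto

lemma fold_act_closed:
  "w \<in> lists (letters \<G>) \<Longrightarrow> x \<in> fib u \<Longrightarrow> fold act w x \<in> fib u"
proof (induction w arbitrary: x)
  case (Cons l w)
  then have "l \<in> letters \<G>" "w \<in> lists (letters \<G>)" by auto
  then show ?case using Cons.IH act_closed Cons.prems(2) by (simp del: mem_Collect_eq)
qed simp

text \<open>The return trip built into the last letter is cancelled by going again to the fibre from
  which it started, so only the bare \<open>shift\<close> or \<open>cross\<close> remains.\<close>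

lemma tr_fold_snoc:
  assumes w: "w \<in> lists (letters \<G>)" and x: "x \<in> fib u"
  shows "v \<in> verts (base \<G>) \<Longrightarrow> g \<in> carrier (vgrp \<G> v) \<Longrightarrow>
      tr u v (fold act (w @ [Elem v g]) x) = shift g (tr u v (fold act w x))"
    and "a \<in> arcs (base \<G>) \<Longrightarrow>
      tr u (trm a) (fold act (w @ [Arc a]) x) = cross a (tr u (org a) (fold act w x))"
proof -
  have u: "u \<in> verts (base \<G>)" using x over_closed by auto
  have z: "fold act w x \<in> fib u" by (rule fold_act_closed[OF w x])
  {
    assume v: "v \<in> verts (base \<G>)" and g: "g \<in> carrier (vgrp \<G> v)"
    have s: "shift g (tr u v (fold act w x)) \<in> fib v" by (rule shift(3)[OF tr_closed[OF z v] g])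
    show "tr u v (fold act (w @ [Elem v g]) x) = shift g (tr u v (fold act w x))"
      by (simp only: fold_append fold.simps o_apply id_apply act_Elem[OF z] tr_trans[OF s u v] tr_self[OF s])
  next
    assume a: "a \<in> arcs (base \<G>)"
    have s: "cross a (tr u (org a) (fold act w x)) \<in> fib (trm a)"
      by (rule cross_closed[OF a tr_closed[OF z base.tail_closed[OF a]]])
    show "tr u (trm a) (fold act (w @ [Arc a]) x) = cross a (tr u (org a) (fold act w x))"
      by (simp only: fold_append fold.simps o_apply id_apply act_Arc[OF z]
          tr_trans[OF s u base.head_closed[OF a]] tr_self[OF s])
  }
qed

text \<open>Transport is invertible, so equality may be tested in whichever fibre suits the relation
  at hand.\<close>

lemma tr_inject:
  assumes "x \<in> fib u" "y \<in> fib u" "v \<in> verts (base \<G>)" "tr u v x = tr u v y"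
  shows "x = y"
proof -
  have u: "u \<in> verts (base \<G>)" using assms(1) over_closed by auto
  have "tr v u (tr u v x) = tr v u (tr u v y)" by (simp only: assms(4))
  then show ?thesis using tr_trans[OF assms(1,3) u] tr_trans[OF assms(2,3) u] tr_self[OF assms(1)] tr_self[OF assms(2)]
    by simp
qed

text \<open>The right action of words descends to \<open>P\<close>. Each relation is compared in one
  fibre: products in a vertex group by associativity of right translation, the conjugation relation
  by \<open>shift_cross\<close>, the tree relation because transport along a spanning tree arc is
  its lift.\<close>

lemma fold_act_word_rel:
  assumes "(w, w') \<in> word_rel \<G> E" "x \<in> fib u"
  shows "fold act w x = fold act w' x"
  using assms
proof (induction arbitrary: x)
  case (append w1 w1' w2 w2')
  have "w1 \<in> lists (letters \<G>)" using append(1) equiv_words by (auto simp: equiv_def)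
  then have "fold act w1 x \<in> fib u" using fold_act_closed append.prems by blast
  then show ?case using append.IH(1)[OF append.prems] append.IH(2) by simp
next
  case (one v)
  have z: "tr u v x \<in> fib v" by (rule tr_closed[OF one.prems one.hyps])
  have cl: "fold act [Elem v \<one>\<^bsub>vgrp \<G> v\<^esub>] x \<in> fib u"
    using one group.is_monoid[OF group_vgrp] by (intro fold_act_closed) (auto simp: Elem_letter)
  interpret G: group "vgrp \<G> v" using one.hyps by (rule group_vgrp)
  have "shift \<one>\<^bsub>vgrp \<G> v\<^esub> (tr u v x) = tr u v x"
    using z vcol_closed[of "tr u v x"] by (intro shift_eq) (auto simp: srel_refl)
  then have "tr u v (fold act [Elem v \<one>\<^bsub>vgrp \<G> v\<^esub>] x) = tr u v x"
    using tr_fold_snoc(1)[of "[]" x u v "\<one>\<^bsub>vgrp \<G> v\<^esub>"] one by simp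
  then have "fold act [Elem v \<one>\<^bsub>vgrp \<G> v\<^esub>] x = x" by (rule tr_inject[OF cl one.prems one.hyps])
  then show ?case by simp
next
  case (mult v g k)
  interpret G: group "vgrp \<G> v" using mult(1) by (rule group_vgrp)
  let ?z = "tr u v x"
  have z: "?z \<in> fib v" by (rule tr_closed[OF mult.prems mult(1)])
  have L: "[Elem v g, Elem v k] \<in> lists (letters \<G>)" "[Elem v (g \<otimes>\<^bsub>vgrp \<G> v\<^esub> k)] \<in> lists (letters \<G>)"
    "[Elem v g] \<in> lists (letters \<G>)"
    using mult by (auto simp: Elem_letter)
  have sz: "shift g ?z \<in> fib v" by (rule shift(3)[OF z mult(2)])
  have "shift (g \<otimes>\<^bsub>vgrp \<G> v\<^esub> k) ?z = shift k (shift g ?z)"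
  proof (rule shift_eq)
    show "(?z, shift k (shift g ?z)) \<in> srel S"
      by (rule srel_trans[OF shift(1)[OF z mult(2)] shift(1)[OF sz mult(3)]])
    have "over ?z = v" "?z \<in> V" using z by auto
    then show "vcol S (shift k (shift g ?z)) = vcol S ?z \<otimes>\<^bsub>vgrp \<G> (over ?z)\<^esub> (g \<otimes>\<^bsub>vgrp \<G> v\<^esub> k)"
      using shift(2)[OF z mult(2)] shift(2)[OF sz mult(3)] vcol_closed[of ?z] mult(2,3)
      by (simp add: G.m_assoc)
  qed
  then have "tr u v (fold act [Elem v g, Elem v k] x) = tr u v (fold act [Elem v (g \<otimes>\<^bsub>vgrp \<G> v\<^esub> k)] x)"
    using tr_fold_snoc(1)[OF L(3) mult.prems mult(1,3)] tr_fold_snoc(1)[of "[]" x u v g]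
      tr_fold_snoc(1)[of "[]" x u v "g \<otimes>\<^bsub>vgrp \<G> v\<^esub> k"] mult
    by (simp del: act.simps)
  then show ?case
    by (rule tr_inject[OF fold_act_closed[OF L(1) mult.prems] fold_act_closed[OF L(2) mult.prems] mult(1)])
next
  case (arev a)
  have L: "[Arc a] \<in> lists (letters \<G>)" "[Arc a, Arc (rv a)] \<in> lists (letters \<G>)"
    using arev by (auto simp: Arc_letter base.arev_in_arcs)
  have z: "tr u (org a) x \<in> fib (org a)" by (rule tr_closed[OF arev.prems base.tail_closed[OF arev.hyps]])
  have "tr u (org a) (fold act [Arc a, Arc (rv a)] x) = cross (rv a) (cross a (tr u (org a) x))"
    using tr_fold_snoc(2)[OF L(1) arev.prems base.arev_in_arcs[OF arev.hyps]]
      tr_fold_snoc(2)[of "[]" x u a] arev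
    by (simp del: act.simps add: base.head_arev base.tail_arev)
  then have "tr u (org a) (fold act [Arc a, Arc (rv a)] x) = tr u (org a) x"
    by (simp only: cross_arev[OF arev.hyps z])
  then have "fold act [Arc a, Arc (rv a)] x = x"
    by (rule tr_inject[OF fold_act_closed[OF L(2) arev.prems] arev.prems base.tail_closed[OF arev.hyps]])
  then show ?case by simp
next
  case (conj a h)
  let ?g = "incl \<G> a h" and ?k = "incl \<G> (rv a) h"
  have g: "?g \<in> carrier (vgrp \<G> (trm a))" by (rule incl_closed[OF conj(1,2)])
  have k: "?k \<in> carrier (vgrp \<G> (org a))" by (rule incl_arev_closed[OF conj(1,2)])
  have v: "org a \<in> verts (base \<G>)" "trm a \<in> verts (base \<G>)" "rv a \<in> arcs (base \<G>)"
    using conj(1) by (simp_all add: base.tail_closed base.head_closed base.arev_in_arcs)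
  have L: "[Arc a] \<in> lists (letters \<G>)" "[Arc a, Elem (trm a) ?g] \<in> lists (letters \<G>)"
    "[Arc a, Elem (trm a) ?g, Arc (rv a)] \<in> lists (letters \<G>)" "[Elem (org a) ?k] \<in> lists (letters \<G>)"
    using conj(1) g k v by (auto simp: Arc_letter Elem_letter)
  have z: "tr u (org a) x \<in> fib (org a)" by (rule tr_closed[OF conj.prems v(1)])
  \<comment> \<open>The word is peeled from the right; \<open>shift_cross\<close> then brings the
    two crossings together so that they cancel.\<close>
  have "tr u (org a) (fold act [Arc a, Elem (trm a) ?g, Arc (rv a)] x) =
      cross (rv a) (tr u (trm a) (fold act [Arc a, Elem (trm a) ?g] x))"
    using tr_fold_snoc(2)[OF L(2) conj.prems v(3)] conj(1)
    by (simp del: act.simps add: base.head_arev base.tail_arev)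
  also have "tr u (trm a) (fold act [Arc a, Elem (trm a) ?g] x) = shift ?g (tr u (trm a) (fold act [Arc a] x))"
    using tr_fold_snoc(1)[OF L(1) conj.prems v(2) g] by (simp del: act.simps)
  also have "tr u (trm a) (fold act [Arc a] x) = cross a (tr u (org a) x)"
    using tr_fold_snoc(2)[of "[]" x u a] conj by (simp del: act.simps)
  also have "shift ?g (cross a (tr u (org a) x)) = cross a (shift ?k (tr u (org a) x))"
    by (rule shift_cross[OF conj(1,2) z])
  also have "cross (rv a) \<dots> = shift ?k (tr u (org a) x)"
    by (rule cross_arev[OF conj(1) shift(3)[OF z k]])
  also have "\<dots> = tr u (org a) (fold act [Elem (org a) ?k] x)"
    using tr_fold_snoc(1)[of "[]" x u "org a" ?k] conj v k by (simp del: act.simps)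
  finally show ?case
    by (rule tr_inject[OF fold_act_closed[OF L(3) conj.prems] fold_act_closed[OF L(4) conj.prems] v(1)])
next
  case (tree a)
  then have a: "a \<in> E" "a \<in> arcs (base \<G>)" by auto
  have L: "[Arc a] \<in> lists (letters \<G>)" using a by (simp add: Arc_letter)
  have v: "org a \<in> verts (base \<G>)" "trm a \<in> verts (base \<G>)"
    using a by (simp_all add: base.tail_closed base.head_closed)
  have z: "tr u (org a) x \<in> fib (org a)" by (rule tr_closed[OF tree.prems v(1)])
  \<comment> \<open>Read at the terminus of \<open>a\<close>, the lift of \<open>a\<close> is the
    transport itself, so the letter changes nothing.\<close>
  have "tr u (trm a) (fold act [Arc a] x) = cross a (tr u (org a) x)"
    using tr_fold_snoc(2)[of "[]" x u a] tree a by (simp del: act.simps)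
  also have "\<dots> = tr u (trm a) x"
    by (simp only: tr_span[OF a(1) z, symmetric] tr_trans[OF tree.prems v])
  finally have "fold act [Arc a] x = x"
    by (rule tr_inject[OF fold_act_closed[OF L tree.prems] tree.prems v(2)])
  then show ?case by simp
qed simp_all

text \<open>A path through classes and arcs spells a word. The same word carries \<open>x\<close> to
  \<open>y\<close> under the right action, up to transport between fibres, and measures the
  difference of coordinates; this ties the coordinate to the action.\<close>

lemma ex_word_between:
  assumes x: "x \<in> V" and y: "y \<in> V"
  shows "\<exists>w\<in>lists (letters \<G>). tr (over x) (over y) (fold act w x) = y \<and>
    coord y = coord x \<otimes>\<^bsub>P\<^esub> cls w"
proof -
  define Q where "Q w z \<longleftrightarrow> w \<in> lists (letters \<G>) \<and> tr (over x) (over z) (fold act w x) = z \<and>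
    coord z = coord x \<otimes>\<^bsub>P\<^esub> cls w" for w z
  have xf: "x \<in> fib (over x)" using x by simp
  have Q_srel: "\<exists>w'. Q w' z'" if Q: "Q w z" and zz': "(z, z') \<in> srel S" for w z z'
  proof -
    have z: "z \<in> V" "z' \<in> V" using srel_V[OF zz'] by auto
    interpret G: group "vgrp \<G> (over z)" using over_closed[OF z(1)] by (rule group_vgrp)
    let ?g = "inv\<^bsub>vgrp \<G> (over z)\<^esub> vcol S z \<otimes>\<^bsub>vgrp \<G> (over z)\<^esub> vcol S z'"
    have c: "vcol S z \<in> carrier (vgrp \<G> (over z))" "vcol S z' \<in> carrier (vgrp \<G> (over z))"
      using vcol_closed[OF z(1)] vcol_closed[OF z(2)] over_cong[OF zz'] by auto
    then have g: "?g \<in> carrier (vgrp \<G> (over z))" by simp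
    have s: "shift ?g z = z'" using c by (intro shift_eq[OF zz']) simp
    have w: "w \<in> lists (letters \<G>)" using Q by (simp add: Q_def)
    have l: "[Elem (over z) ?g] \<in> lists (letters \<G>)" using g z by (simp add: Elem_letter over_closed)
    have "Q (w @ [Elem (over z) ?g]) z'"
      unfolding Q_def
    proof (intro conjI)
      show "w @ [Elem (over z) ?g] \<in> lists (letters \<G>)" using w l by simp
      have "tr (over x) (over z) (fold act (w @ [Elem (over z) ?g]) x) = z'"
        unfolding tr_fold_snoc(1)[OF w xf over_closed[OF z(1)] g] using Q s by (simp add: Q_def)
      then show "tr (over x) (over z') (fold act (w @ [Elem (over z) ?g]) x) = z'"
        using over_cong[OF zz'] by simp
      have "coord z' = coord x \<otimes>\<^bsub>P\<^esub> cls w \<otimes>\<^bsub>P\<^esub> diff z z'"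
        using Q coord_srel[OF zz'] by (simp add: Q_def)
      then show "coord z' = coord x \<otimes>\<^bsub>P\<^esub> cls (w @ [Elem (over z) ?g])"
        using cls_append[OF w l] coord_closed[OF x] cls_closed[OF w] cls_closed[OF l]
        by (simp add: diff_def gen_elem_def P.m_assoc)
    qed
    then show ?thesis by blast
  qed
  have Q_arc: "\<exists>w'. Q w' (dst b)" if Q: "Q w (src b)" and b: "b \<in> B" for w b
  proof -
    have a: "aover b \<in> arcs (base \<G>)" by (rule aover_closed[OF b])
    have w: "w \<in> lists (letters \<G>)" using Q by (simp add: Q_def)
    have l: "[Arc (aover b)] \<in> lists (letters \<G>)" using a by (simp add: Arc_letter)
    have "Q (w @ [Arc (aover b)]) (dst b)"
      unfolding Q_def
    proof (intro conjI)
      show "w @ [Arc (aover b)] \<in> lists (letters \<G>)" using w l by simp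
      show "tr (over x) (over (dst b)) (fold act (w @ [Arc (aover b)]) x) = dst b"
        unfolding over_dst[OF b] tr_fold_snoc(2)[OF w xf a]
        using Q cross_src[OF b] by (simp add: Q_def over_src[OF b])
      show "coord (dst b) = coord x \<otimes>\<^bsub>P\<^esub> cls (w @ [Arc (aover b)])"
        using Q cls_append[OF w l] coord_arc[OF b] coord_closed[OF x] cls_closed[OF w] cls_closed[OF l]
        by (simp add: Q_def gen_arc_def P.m_assoc)
    qed
    then show ?thesis by blast
  qed
  have "Q [] x" using x xf coord_closed[OF x] tr_self[OF xf] by (simp add: Q_def flip: one_eq_cls)
  then have "\<exists>w. Q w y"
    using Q_srel Q_arc by (intro scaffold_induct[OF x y, of "\<lambda>z. \<exists>w. Q w z"]) blast+
  then show ?thesis by (auto simp: Q_def)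
qed

text \<open>If the coordinates agree, the word leading from \<open>x\<close> to \<open>y\<close>
  represents the unit and hence acts trivially; as both vertices lie over the same base vertex, the
  remaining transport is the identity.\<close>

lemma coord_inject:
  assumes x: "x \<in> V" and y: "y \<in> V" and c: "coord x = coord y" and o: "over x = over y"
  shows "x = y"
proof -
  have xf: "x \<in> fib (over x)" using x by simp
  obtain w where w: "w \<in> lists (letters \<G>)" "tr (over x) (over y) (fold act w x) = y"
    "coord y = coord x \<otimes>\<^bsub>P\<^esub> cls w"
    using ex_word_between[OF x y] by blast
  have "coord x = coord x \<otimes>\<^bsub>P\<^esub> cls w" using w(3) unfolding c .
  then have "cls w = cls []"
    unfolding one_eq_cls[symmetric]
    by (rule iffD1[OF P.l_cancel_one'[OF coord_closed[OF x] cls_closed[OF w(1)]]])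
  then have "(w, []) \<in> word_rel \<G> E" using cls_eq_iff[OF w(1), of "[]"] by simp
  from fold_act_word_rel[OF this xf] have "fold act w x = x" by simp
  then have "tr (over x) (over y) x = y" using w(2) by (simp only:)
  then show ?thesis using tr_self[OF xf] o by metis
qed

section \<open>The isomorphism onto the universal group\<close>

text \<open>Unique existence of the image rests on \<open>coord_surj\<close> and
  \<open>coord_inject\<close>. The restriction makes the map extensional, as membership in
  \<open>Bij\<close> demands.\<close>

definition vmap :: "('v, 'a, 'g) letter list set \<Rightarrow> 's \<Rightarrow> 's" where
  "vmap p = (\<lambda>x\<in>V. THE y. y \<in> V \<and> coord y = p \<otimes>\<^bsub>P\<^esub> coord x \<and> over y = over x)"

text \<open>By unique lifting, an automorphism over the base graph is determined on arcs by its
  effect on their origins.\<close>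

definition amap :: "('v, 'a, 'g) letter list set \<Rightarrow> 'b \<Rightarrow> 'b" where
  "amap p = (\<lambda>b\<in>B. THE c. c \<in> B \<and> src c = vmap p (src b) \<and> aover c = aover b)"

lemma vmap:
  assumes "p \<in> carrier P" "x \<in> V"
  shows "vmap p x \<in> V" "coord (vmap p x) = p \<otimes>\<^bsub>P\<^esub> coord x" "over (vmap p x) = over x"
proof -
  have "p \<otimes>\<^bsub>P\<^esub> coord x \<in> carrier P" using assms coord_closed by simp
  then have "\<exists>y\<in>V. coord y = p \<otimes>\<^bsub>P\<^esub> coord x \<and> over y = over x"
    using over_closed[OF assms(2)] by (rule coord_surj)
  then have "\<exists>!y. y \<in> V \<and> coord y = p \<otimes>\<^bsub>P\<^esub> coord x \<and> over y = over x"
    by (metis coord_inject)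
  from theI'[OF this] show "vmap p x \<in> V" "coord (vmap p x) = p \<otimes>\<^bsub>P\<^esub> coord x" "over (vmap p x) = over x"
    using assms by (simp_all add: vmap_def)
qed

lemma vmap_eq:
  assumes "p \<in> carrier P" "x \<in> V" "y \<in> V" "coord y = p \<otimes>\<^bsub>P\<^esub> coord x" "over y = over x"
  shows "vmap p x = y"
  using vmap[OF assms(1,2)] assms(3-) by (intro coord_inject) auto

lemma amap:
  assumes p: "p \<in> carrier P" and b: "b \<in> B"
  shows "amap p b \<in> B" "src (amap p b) = vmap p (src b)" "aover (amap p b) = aover b"
proof -
  have s: "src b \<in> V" by (rule scaf.tail_closed[OF b])
  have "\<exists>c. c \<in> B \<and> src c = vmap p (src b) \<and> aover c = aover b"
    using vmap(1)[OF p s] aover_closed[OF b] over_src[OF b] vmap(3)[OF p s] by (intro ex_arc_out) auto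
  then have "\<exists>!c. c \<in> B \<and> src c = vmap p (src b) \<and> aover c = aover b"
    by (metis arc_out_unique)
  from theI'[OF this] show "amap p b \<in> B" "src (amap p b) = vmap p (src b)" "aover (amap p b) = aover b"
    using b by (simp_all add: amap_def)
qed

lemma amap_eq:
  assumes "p \<in> carrier P" "b \<in> B" "c \<in> B" "src c = vmap p (src b)" "aover c = aover b"
  shows "amap p b = c"
  using amap[OF assms(1,2)] assms(3-) by (intro arc_out_unique) auto

text \<open>Left multiplication by \<open>p\<close> commutes with the right multiplication that
  crossing an arc causes.\<close>

lemma dst_amap:
  assumes p: "p \<in> carrier P" and b: "b \<in> B"
  shows "dst (amap p b) = vmap p (dst b)"
proof -
  have a: "gen_arc \<G> E (aover b) \<in> carrier P" by (rule gen_arc_closed[OF aover_closed[OF b]])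
  have s: "src b \<in> V" by (rule scaf.tail_closed[OF b])
  have "coord (dst (amap p b)) = p \<otimes>\<^bsub>P\<^esub> coord (dst b)"
    unfolding coord_arc[OF amap(1)[OF p b]] coord_arc[OF b] amap(2,3)[OF p b] vmap(2)[OF p s]
    using p coord_closed[OF s] a by (rule P.m_assoc)
  moreover have "over (dst (amap p b)) = over (dst b)"
    using over_dst[OF amap(1)[OF p b]] over_dst[OF b] amap(3)[OF p b] by simp
  ultimately show ?thesis
    using vmap_eq[OF p scaf.head_closed[OF b] scaf.head_closed[OF amap(1)[OF p b]]] by simp
qed

lemma bar_amap:
  assumes p: "p \<in> carrier P" and b: "b \<in> B"
  shows "bar (amap p b) = amap p (bar b)"
  using amap[OF p b] b
  by (intro amap_eq[symmetric, OF p])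
    (simp_all add: scaf.arev_in_arcs scaf.tail_arev aover_rev dst_amap[OF p])

lemma vmap_mult:
  assumes "p \<in> carrier P" "q \<in> carrier P" "x \<in> V"
  shows "vmap (p \<otimes>\<^bsub>P\<^esub> q) x = vmap p (vmap q x)"
  using assms vmap[OF assms(2,3)] vmap[OF assms(1) vmap(1)[OF assms(2,3)]] coord_closed[OF assms(3)]
  by (intro vmap_eq) (simp_all add: P.m_assoc)

lemma amap_mult:
  assumes "p \<in> carrier P" "q \<in> carrier P" "b \<in> B"
  shows "amap (p \<otimes>\<^bsub>P\<^esub> q) b = amap p (amap q b)"
  using assms amap[OF assms(2,3)] amap[OF assms(1) amap(1)[OF assms(2,3)]]
  by (intro amap_eq) (simp_all add: vmap_mult scaf.tail_closed)

lemma vmap_one: "x \<in> V \<Longrightarrow> vmap \<one>\<^bsub>P\<^esub> x = x"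
  by (rule vmap_eq) (simp_all add: coord_closed)

lemma amap_one: "b \<in> B \<Longrightarrow> amap \<one>\<^bsub>P\<^esub> b = b"
  by (rule amap_eq) (simp_all add: vmap_one scaf.tail_closed)

lemma vmap_inv:
  assumes "p \<in> carrier P" "x \<in> V"
  shows "vmap (inv\<^bsub>P\<^esub> p) (vmap p x) = x" "vmap p (vmap (inv\<^bsub>P\<^esub> p) x) = x"
  using assms by (simp_all add: vmap_one flip: vmap_mult)

lemma amap_inv:
  assumes "p \<in> carrier P" "b \<in> B"
  shows "amap (inv\<^bsub>P\<^esub> p) (amap p b) = b" "amap p (amap (inv\<^bsub>P\<^esub> p) b) = b"
  using assms by (simp_all add: amap_one flip: amap_mult)

lemma vmap_Bij:
  assumes p: "p \<in> carrier P" shows "vmap p \<in> Bij V"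
proof -
  have "bij_betw (vmap p) V V"
    by (rule bij_betw_byWitness[where f' = "vmap (inv\<^bsub>P\<^esub> p)"])
      (use p in \<open>auto simp: vmap_inv vmap(1)\<close>)
  then show ?thesis by (simp add: Bij_def) (simp add: vmap_def)
qed

lemma amap_Bij:
  assumes p: "p \<in> carrier P" shows "amap p \<in> Bij B"
proof -
  have "bij_betw (amap p) B B"
    by (rule bij_betw_byWitness[where f' = "amap (inv\<^bsub>P\<^esub> p)"])
      (use p in \<open>auto simp: amap_inv amap(1)\<close>)
  then show ?thesis by (simp add: Bij_def) (simp add: amap_def)
qed

text \<open>The vertex obtained from \<open>vmap p x\<close> by right translation with the colour
  quotient of \<open>x\<close> and \<open>y\<close> has the coordinate required of
  \<open>vmap p y\<close>, so it is that vertex. The second claim, invariance of colour quotients,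
  is the algebraic form of acceptability.\<close>

lemma vmap_related:
  assumes p: "p \<in> carrier P" and xy: "(x, y) \<in> srel S"
  shows "(vmap p x, vmap p y) \<in> srel S"
    and "vcol S (vmap p y) = vcol S (vmap p x) \<otimes>\<^bsub>vgrp \<G> (over x)\<^esub>
      (inv\<^bsub>vgrp \<G> (over x)\<^esub> vcol S x \<otimes>\<^bsub>vgrp \<G> (over x)\<^esub> vcol S y)"
proof -
  have V: "x \<in> V" "y \<in> V" using srel_V[OF xy] by auto
  interpret G: group "vgrp \<G> (over x)" using over_closed[OF V(1)] by (rule group_vgrp)
  let ?g = "inv\<^bsub>vgrp \<G> (over x)\<^esub> vcol S x \<otimes>\<^bsub>vgrp \<G> (over x)\<^esub> vcol S y"
  have g: "?g \<in> carrier (vgrp \<G> (over x))"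
    by (intro G.m_closed G.inv_closed vcol_closed V(1) vcol_closed[OF V(2), folded over_cong[OF xy]])
  have x': "vmap p x \<in> fib (over x)" using vmap[OF p V(1)] by simp
  note z = shift[OF x' g]
  have zV: "shift ?g (vmap p x) \<in> V" "over (shift ?g (vmap p x)) = over y"
    using z(3) over_cong[OF xy] by auto
  have d: "diff (vmap p x) (shift ?g (vmap p x)) = diff x y"
    using diff_eq_gen_elem[of "vmap p x" ?g "shift ?g (vmap p x)"] x' g z(2) by (simp add: diff_def)
  have "coord (shift ?g (vmap p x)) = p \<otimes>\<^bsub>P\<^esub> coord y"
    unfolding coord_srel[OF z(1)] coord_srel[OF xy] d vmap(2)[OF p V(1)]
    using p coord_closed[OF V(1)] diff_closed[OF xy] by (rule P.m_assoc)
  then have "vmap p y = shift ?g (vmap p x)" by (intro vmap_eq p V zV)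
  then show "(vmap p x, vmap p y) \<in> srel S"
    "vcol S (vmap p y) = vcol S (vmap p x) \<otimes>\<^bsub>vgrp \<G> (over x)\<^esub> ?g"
    using z by simp_all
qed

lemma vmap_srel_iff:
  assumes p: "p \<in> carrier P" and x: "x \<in> V" and y: "y \<in> V"
  shows "(vmap p x, vmap p y) \<in> srel S \<longleftrightarrow> (x, y) \<in> srel S"
proof
  assume "(vmap p x, vmap p y) \<in> srel S"
  then have "(vmap (inv\<^bsub>P\<^esub> p) (vmap p x), vmap (inv\<^bsub>P\<^esub> p) (vmap p y)) \<in> srel S"
    by (rule vmap_related(1)[OF P.inv_closed[OF p]])
  then show "(x, y) \<in> srel S"
    by (simp only: vmap_inv[OF p x] vmap_inv[OF p y])
qed (rule vmap_related(1)[OF p])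

lemma local_perm_vmap:
  assumes p: "p \<in> carrier P" and C: "C \<in> verts (stree S)"
  shows "local_perm (regular_actions \<G>) S (vmap p) C \<in>
    left_regular (vgrp \<G> (vproj S C)) ` carrier (vgrp \<G> (vproj S C))"
proof -
  obtain x where x: "x \<in> V" "C = srel S `` {x}" using C by (auto simp: verts_stree elim: quotientE)
  have o: "vproj S C = over x" by (simp add: x(2) over_def)
  interpret G: group "vgrp \<G> (over x)" using over_closed[OF x(1)] by (rule group_vgrp)
  \<comment> \<open>The only left translation sending the colour of \<open>x\<close> to that of its
    image; as colour quotients are invariant, it is right for the entire class.\<close>
  let ?g = "vcol S (vmap p x) \<otimes>\<^bsub>vgrp \<G> (over x)\<^esub> inv\<^bsub>vgrp \<G> (over x)\<^esub> vcol S x"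
  have c: "vcol S x \<in> carrier (vgrp \<G> (over x))" "vcol S (vmap p x) \<in> carrier (vgrp \<G> (over x))"
    using vcol_closed[OF x(1)] vcol_closed[OF vmap(1)[OF p x(1)]] vmap(3)[OF p x(1)] by simp_all
  have "local_perm (regular_actions \<G>) S (vmap p) C = left_regular (vgrp \<G> (over x)) ?g"
  proof
    fix z
    show "local_perm (regular_actions \<G>) S (vmap p) C z = left_regular (vgrp \<G> (over x)) ?g z"
    proof (cases "z \<in> carrier (vgrp \<G> (over x))")
      case z: True
      define y where "y = inv_into C (vcol S) z"
      have "z \<in> vcol S ` C" using z by (simp add: x(2) bij_betw_imp_surj_on[OF vcol_bij_class[OF x(1)]])
      then have y: "y \<in> C" "vcol S y = z" unfolding y_def by (rule inv_into_into, rule f_inv_into_f)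
      then have "(x, y) \<in> srel S" by (simp add: x(2))
      from vmap_related(2)[OF p this] z c y(2)
      show ?thesis by (simp add: local_perm_def o left_regular_def G.m_assoc flip: y_def)
    qed (simp add: local_perm_def o left_regular_def)
  qed
  moreover have "?g \<in> carrier (vgrp \<G> (over x))" using c by simp
  ultimately show ?thesis unfolding o by (rule image_eqI)
qed

section \<open>The correspondence between the two groups\<close>

abbreviation "U \<equiv> universal_group (regular_actions \<G>) S"

definition iso_map :: "('v, 'a, 'g) letter list set \<Rightarrow> ('s \<Rightarrow> 's) \<times> ('b \<Rightarrow> 'b)" where
  "iso_map p = (vmap p, amap p)"

lemma carrier_U: "(f, f') \<in> carrier U \<longleftrightarrow> f \<in> Bij V \<and> f' \<in> Bij B \<and>
    rgraph_hom (sgraph S) (sgraph S) f f' \<and>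
    (\<forall>x\<in>V. \<forall>y\<in>V. (f x, f y) \<in> srel S \<longleftrightarrow> (x, y) \<in> srel S) \<and>
    (\<forall>x\<in>V. over (f x) = over x) \<and> (\<forall>b\<in>B. aover (f' b) = aover b) \<and>
    (\<forall>C\<in>verts (stree S). local_perm (regular_actions \<G>) S f C \<in>
      left_regular (vgrp \<G> (vproj S C)) ` carrier (vgrp \<G> (vproj S C)))"
  unfolding universal_group_def over_def aover_def by simp

lemma mult_U: "(f, f') \<otimes>\<^bsub>U\<^esub> (k, k') =
    (f \<otimes>\<^bsub>BijGroup V\<^esub> k, f' \<otimes>\<^bsub>BijGroup B\<^esub> k')"
  by (simp add: universal_group_def DirProd_def)

lemma iso_map_closed: "p \<in> carrier P \<Longrightarrow> iso_map p \<in> carrier U"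
  unfolding iso_map_def carrier_U
  by (auto simp: vmap_Bij amap_Bij rgraph_hom_def vmap amap dst_amap bar_amap vmap_srel_iff
      local_perm_vmap)

lemma iso_map_mult:
  assumes p: "p \<in> carrier P" and q: "q \<in> carrier P"
  shows "iso_map (p \<otimes>\<^bsub>P\<^esub> q) = iso_map p \<otimes>\<^bsub>U\<^esub> iso_map q"
proof -
  have "vmap (p \<otimes>\<^bsub>P\<^esub> q) = compose V (vmap p) (vmap q)"
  proof
    fix x show "vmap (p \<otimes>\<^bsub>P\<^esub> q) x = compose V (vmap p) (vmap q) x"
      by (cases "x \<in> V") (simp_all add: vmap_mult[OF p q] compose_def, simp add: vmap_def)
  qed
  moreover have "amap (p \<otimes>\<^bsub>P\<^esub> q) = compose B (amap p) (amap q)"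
  proof
    fix x show "amap (p \<otimes>\<^bsub>P\<^esub> q) x = compose B (amap p) (amap q) x"
      by (cases "x \<in> B") (simp_all add: amap_mult[OF p q] compose_def, simp add: amap_def)
  qed
  ultimately show ?thesis
    unfolding iso_map_def mult_U by (simp add: BijGroup_def vmap_Bij amap_Bij p q)
qed

text \<open>Acceptability multiplies all colours of a class on the left by one \<open>g\<close>,
  which cancels in the quotient.\<close>

lemma diff_acceptable:
  assumes u: "(f, f') \<in> carrier U" and xy: "(x, y) \<in> srel S"
  shows "diff (f x) (f y) = diff x y"
proof -
  have V: "x \<in> V" "y \<in> V" using srel_V[OF xy] by auto
  interpret G: group "vgrp \<G> (over x)" using over_closed[OF V(1)] by (rule group_vgrp)
  let ?C = "srel S `` {x}"
  have o: "vproj S ?C = over x" by (simp add: over_def)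
  have "local_perm (regular_actions \<G>) S f ?C \<in>
      left_regular (vgrp \<G> (over x)) ` carrier (vgrp \<G> (over x))"
    using u class_in_stree[OF V(1)] unfolding carrier_U o[symmetric] by blast
  then obtain g where g: "g \<in> carrier (vgrp \<G> (over x))"
    and *: "local_perm (regular_actions \<G>) S f ?C = left_regular (vgrp \<G> (over x)) g" by blast
  have cols: "vcol S z \<in> carrier (vgrp \<G> (over x)) \<and>
      vcol S (f z) = g \<otimes>\<^bsub>vgrp \<G> (over x)\<^esub> vcol S z" if z: "(x, z) \<in> srel S" for z
  proof -
    have c: "vcol S z \<in> carrier (vgrp \<G> (over x))"
      using vcol_closed[of z] srel_V[OF z] over_cong[OF z] by simp
    have "inv_into ?C (vcol S) (vcol S z) = z"
      using z by (intro inv_into_f_f bij_betw_imp_inj_on[OF vcol_bij_class[OF V(1)]]) simp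
    then show ?thesis using fun_cong[OF *, of "vcol S z"] c
      by (simp add: local_perm_def left_regular_def o)
  qed
  have "over (f x) = over x" using u V by (simp add: carrier_U)
  moreover have "inv\<^bsub>vgrp \<G> (over x)\<^esub> vcol S (f x) \<otimes>\<^bsub>vgrp \<G> (over x)\<^esub> vcol S (f y) =
      inv\<^bsub>vgrp \<G> (over x)\<^esub> vcol S x \<otimes>\<^bsub>vgrp \<G> (over x)\<^esub> vcol S y"
    using cols[OF xy] cols[OF srel_refl[OF V(1)]] g by (simp add: G.inv_mult_group G.m_assoc)
  ultimately show ?thesis by (simp add: diff_def)
qed

text \<open>An element of the universal group is compatible with both kinds of moves, just as left
  multiplication is, so one value determines it on vertices; on arcs it is determined by unique
  lifting.\<close>

lemma iso_map_surj:
  assumes u: "(f, f') \<in> carrier U"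
  shows "\<exists>p\<in>carrier P. (f, f') = iso_map p"
proof -
  have f: "f \<in> Bij V" "f' \<in> Bij B" using u by (simp_all add: carrier_U)
  have fV: "f x \<in> V" "over (f x) = over x" if "x \<in> V" for x
    using u that by (auto simp: carrier_U rgraph_hom_def)
  have fB: "f' b \<in> B" "aover (f' b) = aover b" "src (f' b) = f (src b)" "dst (f' b) = f (dst b)"
    if "b \<in> B" for b
    using u that by (auto simp: carrier_U rgraph_hom_def)
  obtain x0 where x0: "x0 \<in> V" "coord x0 = \<one>\<^bsub>P\<^esub>" using coord_one by blast
  \<comment> \<open>As \<open>x0\<close> has coordinate \<open>\<one>\<close>, left multiplication
    by \<open>p\<close> sends \<open>x0\<close> to a vertex with coordinate \<open>p\<close>, so no
    other choice is possible.\<close>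
  define p where "p = coord (f x0)"
  have p: "p \<in> carrier P" unfolding p_def by (rule coord_closed[OF fV(1)[OF x0(1)]])
  have "coord (f y) = p \<otimes>\<^bsub>P\<^esub> coord y" if "y \<in> V" for y
  proof (rule scaffold_induct[OF x0(1) that])
    show "coord (f x0) = p \<otimes>\<^bsub>P\<^esub> coord x0" using p x0(2) by (simp flip: p_def)
  next
    fix x y assume xy: "(x, y) \<in> srel S" and IH: "coord (f x) = p \<otimes>\<^bsub>P\<^esub> coord x"
    have V: "x \<in> V" "y \<in> V" using srel_V[OF xy] by auto
    have "(f x, f y) \<in> srel S" using u V xy by (simp add: carrier_U)
    from coord_srel[OF this] show "coord (f y) = p \<otimes>\<^bsub>P\<^esub> coord y"
      unfolding coord_srel[OF xy] diff_acceptable[OF u xy] IH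
      using P.m_assoc[OF p coord_closed[OF V(1)] diff_closed[OF xy]] by simp
  next
    fix b assume b: "b \<in> B" and IH: "coord (f (src b)) = p \<otimes>\<^bsub>P\<^esub> coord (src b)"
    have "coord (f (dst b)) = p \<otimes>\<^bsub>P\<^esub> coord (src b) \<otimes>\<^bsub>P\<^esub> gen_arc \<G> E (aover b)"
      using coord_arc[OF fB(1)[OF b]] fB[OF b] IH by simp
    also have "\<dots> = p \<otimes>\<^bsub>P\<^esub> coord (dst b)"
      unfolding coord_arc[OF b]
      using p coord_closed[OF scaf.tail_closed[OF b]] gen_arc_closed[OF aover_closed[OF b]]
      by (rule P.m_assoc)
    finally show "coord (f (dst b)) = p \<otimes>\<^bsub>P\<^esub> coord (dst b)" .
  qed
  then have v: "vmap p x = f x" if "x \<in> V" for x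
    using that fV by (intro vmap_eq p) simp_all
  have a: "amap p b = f' b" if "b \<in> B" for b
    using that fB[OF that] by (intro amap_eq p) (simp_all add: v scaf.tail_closed)
  have "f = vmap p"
    by (rule extensionalityI[of _ V]) (use f v vmap_Bij[OF p] in \<open>auto simp: Bij_def\<close>)
  moreover have "f' = amap p"
    by (rule extensionalityI[of _ B]) (use f a amap_Bij[OF p] in \<open>auto simp: Bij_def\<close>)
  ultimately show ?thesis using p by (auto simp: iso_map_def)
qed

lemma iso_map_iso: "iso_map \<in> iso P U"
proof (rule isoI)
  show "iso_map \<in> hom P U"
    by (rule homI) (simp_all add: iso_map_closed iso_map_mult)
  obtain x0 where x0: "x0 \<in> V" "coord x0 = \<one>\<^bsub>P\<^esub>" using coord_one by blast
  have "inj_on iso_map (carrier P)"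
  proof (rule inj_onI)
    fix p q assume pq: "p \<in> carrier P" "q \<in> carrier P" "iso_map p = iso_map q"
    then have "coord (vmap p x0) = coord (vmap q x0)" by (simp add: iso_map_def)
    then show "p = q" using pq x0 by (simp add: vmap)
  qed
  moreover have "iso_map ` carrier P = carrier U"
    using iso_map_surj iso_map_closed by (auto simp: image_iff)
  ultimately show "bij_betw iso_map (carrier P) (carrier U)" by (simp add: bij_betw_def)
qed

section \<open>The isomorphism of trees\<close>

text \<open>Within a class the colours run through the entire vertex group, so the coordinates fill
  a left coset.\<close>

lemma coord_class:
  assumes x: "x \<in> V"
  shows "coord ` (srel S `` {x}) = coord x <#\<^bsub>P\<^esub> vert_subgroup \<G> E (over x)"
proof (intro equalityI subsetI)
  fix p assume "p \<in> coord ` (srel S `` {x})"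
  then obtain y where y: "(x, y) \<in> srel S" "p = coord y" by auto
  interpret G: group "vgrp \<G> (over x)" using over_closed[OF x] by (rule group_vgrp)
  have "y \<in> V" using srel_V[OF y(1)] by blast
  then have "inv\<^bsub>vgrp \<G> (over x)\<^esub> vcol S x \<otimes>\<^bsub>vgrp \<G> (over x)\<^esub> vcol S y \<in> carrier (vgrp \<G> (over x))"
    by (intro G.m_closed G.inv_closed vcol_closed[OF x] vcol_closed[of y, folded over_cong[OF y(1)]])
  then have "diff x y \<in> vert_subgroup \<G> E (over x)"
    by (auto simp: diff_def vert_subgroup_def)
  then show "p \<in> coord x <#\<^bsub>P\<^esub> vert_subgroup \<G> E (over x)"
    using coord_srel[OF y(1)] y(2) by (auto simp: l_coset_def)
next
  fix p assume "p \<in> coord x <#\<^bsub>P\<^esub> vert_subgroup \<G> E (over x)"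
  then obtain g where g: "g \<in> carrier (vgrp \<G> (over x))" "p = coord x \<otimes>\<^bsub>P\<^esub> gen_elem \<G> E (over x) g"
    by (auto simp: l_coset_def vert_subgroup_def)
  have "x \<in> fib (over x)" using x by simp
  note y = shift[OF this g(1)]
  have "p = coord (shift g x)"
    using coord_srel[OF y(1)] diff_eq_gen_elem[OF x g(1) y(2)] g(2) by simp
  then show "p \<in> coord ` (srel S `` {x})" using y(1) by blast
qed

text \<open>The coset representative attached to an arc depends on whether it is positively oriented,
  as in \<^const>\<open>arc_subgroup\<close>.\<close>

definition acoord :: "'a set \<Rightarrow> 'b \<Rightarrow> ('v, 'a, 'g) letter list set" where
  "acoord A b = (if aover b \<in> A then coord (src b) else coord (dst b))"

lemma acoord_closed: "b \<in> B \<Longrightarrow> acoord A b \<in> carrier P"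
  by (simp add: acoord_def coord_closed scaf.tail_closed scaf.head_closed)

lemma arc_subgroup_eq:
  assumes "a \<in> arcs (base \<G>)"
  shows "arc_subgroup \<G> E A a =
    (if a \<in> A then (\<lambda>h. gen_elem \<G> E (org a) (incl \<G> (rv a) h)) ` carrier (agrp \<G> a)
     else (\<lambda>h. gen_elem \<G> E (trm a) (incl \<G> a h)) ` carrier (agrp \<G> a))"
  using assms by (simp add: arc_subgroup_def image_image base.tail_arev base.arev_arev agrp_arev)

text \<open>\<open>h\<close> is the displacement between two arcs of one class. At the end used by
  \<open>acoord\<close> it acts through the embedding that defines \<open>arc_subgroup\<close>, so
  the values on a class stay in one coset.\<close>

lemma acoord_related:
  assumes bc: "(b, c) \<in> brel"
  defines "h \<equiv> inv\<^bsub>agrp \<G> (aover b)\<^esub> acol S b \<otimes>\<^bsub>agrp \<G> (aover b)\<^esub> acol S c"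
  shows "h \<in> carrier (agrp \<G> (aover b))"
    and "acoord A c = acoord A b \<otimes>\<^bsub>P\<^esub>
      (if aover b \<in> A then gen_elem \<G> E (org (aover b)) (incl \<G> (rv (aover b)) h)
       else gen_elem \<G> E (trm (aover b)) (incl \<G> (aover b) h))"
proof -
  have b: "b \<in> B" and c: "c \<in> B" using brel_B[OF bc] by auto
  have a: "aover b \<in> arcs (base \<G>)" by (rule aover_closed[OF b])
  interpret H: group "agrp \<G> (aover b)" using a by (rule group_agrp)
  show h: "h \<in> carrier (agrp \<G> (aover b))" unfolding h_def
    by (intro H.m_closed H.inv_closed acol_closed[OF b] acol_closed[OF c, folded aover_cong[OF bc]])
  have s: "(src b, src c) \<in> srel S" and t: "(dst b, dst c) \<in> srel S"
    using bc by (auto simp: arc_rel_def)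
  have "diff (dst b) (dst c) = gen_elem \<G> E (trm (aover b)) (incl \<G> (aover b) h)"
    using diff_eq_gen_elem[OF scaf.head_closed[OF b] _ dst_colour_diff[OF bc, folded h_def]]
      incl_closed[OF a h]
    by (simp add: over_dst[OF b])
  moreover have "diff (src b) (src c) = gen_elem \<G> E (org (aover b)) (incl \<G> (rv (aover b)) h)"
    using diff_eq_gen_elem[OF scaf.tail_closed[OF b] _ src_colour_diff[OF bc, folded h_def]]
      incl_arev_closed[OF a h]
    by (simp add: over_src[OF b])
  ultimately show "acoord A c = acoord A b \<otimes>\<^bsub>P\<^esub>
      (if aover b \<in> A then gen_elem \<G> E (org (aover b)) (incl \<G> (rv (aover b)) h)
       else gen_elem \<G> E (trm (aover b)) (incl \<G> (aover b) h))"
    using coord_srel[OF s] coord_srel[OF t] by (simp add: acoord_def flip: aover_cong[OF bc])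
qed

lemma acoord_class:
  assumes b: "b \<in> B"
  shows "acoord A ` (brel `` {b}) = acoord A b <#\<^bsub>P\<^esub> arc_subgroup \<G> E A (aover b)"
proof (intro equalityI subsetI)
  fix p assume "p \<in> acoord A ` (brel `` {b})"
  then obtain c where c: "(b, c) \<in> brel" "p = acoord A c" by auto
  show "p \<in> acoord A b <#\<^bsub>P\<^esub> arc_subgroup \<G> E A (aover b)"
    unfolding l_coset_def arc_subgroup_eq[OF aover_closed[OF b]]
    using acoord_related(1)[OF c(1)] acoord_related(2)[OF c(1), of A] c(2) by auto
next
  fix p assume "p \<in> acoord A b <#\<^bsub>P\<^esub> arc_subgroup \<G> E A (aover b)"
  then obtain h where h: "h \<in> carrier (agrp \<G> (aover b))"
    and p: "p = acoord A b \<otimes>\<^bsub>P\<^esub>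
      (if aover b \<in> A then gen_elem \<G> E (org (aover b)) (incl \<G> (rv (aover b)) h)
       else gen_elem \<G> E (trm (aover b)) (incl \<G> (aover b) h))"
    unfolding l_coset_def arc_subgroup_eq[OF aover_closed[OF b]] by (auto split: if_splits)
  interpret H: group "agrp \<G> (aover b)" using aover_closed[OF b] by (rule group_agrp)
  have "acol S b \<otimes>\<^bsub>agrp \<G> (aover b)\<^esub> h \<in> carrier (agrp \<G> (aover b))"
    using acol_closed[OF b] h by simp
  then obtain c where c: "(b, c) \<in> brel" "acol S c = acol S b \<otimes>\<^bsub>agrp \<G> (aover b)\<^esub> h"
    using ex_acol[OF b] by blast
  have "p = acoord A c"
    using acoord_related(2)[OF c(1), of A] c(2) p acol_closed[OF b] h by simp
  then show "p \<in> acoord A ` (brel `` {b})" using c(1) by blast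
qed

definition vnode :: "'s \<Rightarrow> 'v \<times> ('v, 'a, 'g) letter list set set" where
  "vnode x = (over x, coord ` (srel S `` {x}))"

definition anode :: "'a set \<Rightarrow> 'b \<Rightarrow> 'a \<times> ('v, 'a, 'g) letter list set set" where
  "anode A b = (aover b, acoord A ` (brel `` {b}))"

lemma verts_bass_serre: "verts (bass_serre_tree \<G> E A) = vnode ` V"
proof -
  have "verts (bass_serre_tree \<G> E A) =
      {(v, p <#\<^bsub>P\<^esub> vert_subgroup \<G> E v) | v p. v \<in> verts (base \<G>) \<and> p \<in> carrier P}"
    by (simp add: bass_serre_tree_def Let_def)
  also have "\<dots> = vnode ` V"
  proof (intro equalityI subsetI)
    fix X assume "X \<in> {(v, p <#\<^bsub>P\<^esub> vert_subgroup \<G> E v) | v p. v \<in> verts (base \<G>) \<and> p \<in> carrier P}"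
    then obtain v p where X: "X = (v, p <#\<^bsub>P\<^esub> vert_subgroup \<G> E v)" "v \<in> verts (base \<G>)" "p \<in> carrier P"
      by blast
    then obtain x where "x \<in> V" "coord x = p" "over x = v" using coord_surj by blast
    then show "X \<in> vnode ` V" using X coord_class by (auto simp: vnode_def)
  next
    fix X assume "X \<in> vnode ` V"
    then obtain x where "x \<in> V" "X = (over x, coord x <#\<^bsub>P\<^esub> vert_subgroup \<G> E (over x))"
      using coord_class by (auto simp: vnode_def)
    then show "X \<in> {(v, p <#\<^bsub>P\<^esub> vert_subgroup \<G> E v) | v p. v \<in> verts (base \<G>) \<and> p \<in> carrier P}"
      using coord_closed over_closed by blast
  qed
  finally show ?thesis .
qed

section \<open>Arcs of the Bass--Serre tree for a fixed orientation, and equivariance\<close>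

context
  fixes A :: "'a set"
  assumes A: "orientation (base \<G>) A"
begin

lemma arev_orientation:
  assumes a: "a \<in> arcs (base \<G>)"
  shows "rv a \<in> A \<longleftrightarrow> a \<notin> A"
proof
  assume "rv a \<in> A"
  then show "a \<notin> A" using A by (auto simp: orientation_def)
next
  assume "a \<notin> A"
  then obtain c where c: "c \<in> A" "a = rv c" using A a by (auto simp: orientation_def)
  then have "c \<in> arcs (base \<G>)" using A by (auto simp: orientation_def)
  then show "rv a \<in> A" using c base.arev_arev by simp
qed

lemma acoord_bar: "b \<in> B \<Longrightarrow> acoord A (bar b) = acoord A b"
  by (simp add: acoord_def aover_rev arev_orientation aover_closed scaf.tail_arev scaf.head_arev)

text \<open>An arc in \<open>A\<close> is lifted at a vertex with coordinate \<open>p\<close> over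
  its origin. The remaining arcs follow by reversal, which leaves \<open>acoord\<close>
  unchanged.\<close>

lemma acoord_surj:
  assumes p: "p \<in> carrier P" and a: "a \<in> arcs (base \<G>)"
  shows "\<exists>b\<in>B. acoord A b = p \<and> aover b = a"
proof -
  have pos: "\<exists>b\<in>B. acoord A b = p \<and> aover b = c" if c: "c \<in> A" "c \<in> arcs (base \<G>)" for c
  proof -
    obtain x where x: "x \<in> V" "coord x = p" "over x = org c"
      using coord_surj[OF p] base.tail_closed[OF c(2)] by blast
    obtain b where "b \<in> B" "src b = x" "aover b = c" using ex_arc_out[OF x(1) c(2)] x(3) by auto
    then show ?thesis using x c(1) by (intro bexI[of _ b]) (simp_all add: acoord_def)
  qed
  show ?thesis
  proof (cases "a \<in> A")
    case False
    then obtain b where b: "b \<in> B" "acoord A b = p" "aover b = rv a"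
      using pos[of "rv a"] arev_orientation[OF a] base.arev_in_arcs[OF a] by blast
    then show ?thesis
      by (intro bexI[of _ "bar b"]) (simp_all add: acoord_bar aover_rev base.arev_arev[OF a] scaf.arev_in_arcs)
  qed (use pos a in blast)
qed

lemma arcs_bass_serre: "arcs (bass_serre_tree \<G> E A) = anode A ` B"
proof -
  have "arcs (bass_serre_tree \<G> E A) =
      {(a, p <#\<^bsub>P\<^esub> arc_subgroup \<G> E A a) | a p. a \<in> arcs (base \<G>) \<and> p \<in> carrier P}"
    by (simp add: bass_serre_tree_def Let_def)
  also have "\<dots> = anode A ` B"
  proof (intro equalityI subsetI)
    fix X assume "X \<in> {(a, p <#\<^bsub>P\<^esub> arc_subgroup \<G> E A a) | a p. a \<in> arcs (base \<G>) \<and> p \<in> carrier P}"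
    then obtain a p where X: "X = (a, p <#\<^bsub>P\<^esub> arc_subgroup \<G> E A a)" "a \<in> arcs (base \<G>)" "p \<in> carrier P"
      by blast
    then obtain b where "b \<in> B" "acoord A b = p" "aover b = a" using acoord_surj by blast
    then show "X \<in> anode A ` B" using X acoord_class by (auto simp: anode_def)
  next
    fix X assume "X \<in> anode A ` B"
    then obtain b where "b \<in> B" "X = (aover b, acoord A b <#\<^bsub>P\<^esub> arc_subgroup \<G> E A (aover b))"
      using acoord_class by (auto simp: anode_def)
    then show "X \<in> {(a, p <#\<^bsub>P\<^esub> arc_subgroup \<G> E A a) | a p. a \<in> arcs (base \<G>) \<and> p \<in> carrier P}"
      using acoord_closed aover_closed by blast
  qed
  finally show ?thesis .
qed

text \<open>The tail is a union over a coset, all of whose members give the same term: for an arc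
  outside \<open>A\<close>, the inverse of the generator turns the terminus coordinate into the
  origin coordinate.\<close>

lemma tail_bass_serre:
  assumes b: "b \<in> B"
  shows "tail (bass_serre_tree \<G> E A) (anode A b) = vnode (src b)"
proof -
  have eq: "(if aover b \<in> A then acoord A c else acoord A c \<otimes>\<^bsub>P\<^esub> inv\<^bsub>P\<^esub> gen_arc \<G> E (aover b)) <#\<^bsub>P\<^esub>
      vert_subgroup \<G> E (org (aover b)) = coord ` (srel S `` {src b})" if bc: "(b, c) \<in> brel" for c
  proof -
    have c: "c \<in> B" "aover c = aover b" using brel_B[OF bc] aover_cong[OF bc] by auto
    have "coord (src c) \<in> carrier P" "gen_arc \<G> E (aover b) \<in> carrier P"
      using coord_closed scaf.tail_closed[OF c(1)] gen_arc_closed aover_closed[OF b] by auto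
    then have "(if aover b \<in> A then acoord A c else acoord A c \<otimes>\<^bsub>P\<^esub> inv\<^bsub>P\<^esub> gen_arc \<G> E (aover b)) =
        coord (src c)"
      using coord_arc[OF c(1)] c(2) by (simp add: acoord_def P.m_assoc)
    moreover have "srel S `` {src c} = srel S `` {src b}"
      using bc by (intro srel_class_eq srel_sym[of "src b"]) (simp add: arc_rel_def)
    ultimately show ?thesis
      using coord_class[OF scaf.tail_closed[OF c(1)]] over_src[OF c(1)] c(2) by simp
  qed
  have "tail (bass_serre_tree \<G> E A) (anode A b) = (org (aover b), \<Union>c\<in>brel `` {b}.
      (if aover b \<in> A then acoord A c else acoord A c \<otimes>\<^bsub>P\<^esub> inv\<^bsub>P\<^esub> gen_arc \<G> E (aover b)) <#\<^bsub>P\<^esub>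
      vert_subgroup \<G> E (org (aover b)))"
    by (simp add: bass_serre_tree_def Let_def anode_def)
  also have "\<dots> = (org (aover b), \<Union>c\<in>brel `` {b}. coord ` (srel S `` {src b}))"
    by (intro arg_cong2[of _ _ _ _ Pair] SUP_cong HOL.refl eq) simp
  also have "\<dots> = vnode (src b)"
    using brel_refl[OF b] over_src[OF b] by (auto simp: vnode_def)
  finally show ?thesis .
qed

lemma head_bass_serre:
  assumes b: "b \<in> B"
  shows "head (bass_serre_tree \<G> E A) (anode A b) = vnode (dst b)"
proof -
  have eq: "(if aover b \<in> A then acoord A c \<otimes>\<^bsub>P\<^esub> gen_arc \<G> E (aover b) else acoord A c) <#\<^bsub>P\<^esub>
      vert_subgroup \<G> E (trm (aover b)) = coord ` (srel S `` {dst b})" if bc: "(b, c) \<in> brel" for c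
  proof -
    have c: "c \<in> B" "aover c = aover b" using brel_B[OF bc] aover_cong[OF bc] by auto
    have "(if aover b \<in> A then acoord A c \<otimes>\<^bsub>P\<^esub> gen_arc \<G> E (aover b) else acoord A c) = coord (dst c)"
      using coord_arc[OF c(1)] c(2) by (simp add: acoord_def)
    moreover have "srel S `` {dst c} = srel S `` {dst b}"
      using bc by (intro srel_class_eq srel_sym[of "dst b"]) (simp add: arc_rel_def)
    ultimately show ?thesis
      using coord_class[OF scaf.head_closed[OF c(1)]] over_dst[OF c(1)] c(2) by simp
  qed
  have "head (bass_serre_tree \<G> E A) (anode A b) = (trm (aover b), \<Union>c\<in>brel `` {b}.
      (if aover b \<in> A then acoord A c \<otimes>\<^bsub>P\<^esub> gen_arc \<G> E (aover b) else acoord A c) <#\<^bsub>P\<^esub>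
      vert_subgroup \<G> E (trm (aover b)))"
    by (simp add: bass_serre_tree_def Let_def anode_def)
  also have "\<dots> = (trm (aover b), \<Union>c\<in>brel `` {b}. coord ` (srel S `` {dst b}))"
    by (intro arg_cong2[of _ _ _ _ Pair] SUP_cong HOL.refl eq) simp
  also have "\<dots> = vnode (dst b)"
    using brel_refl[OF b] over_dst[OF b] by (auto simp: vnode_def)
  finally show ?thesis .
qed

lemma bar_class:
  assumes b: "b \<in> B" shows "brel `` {bar b} = bar ` (brel `` {b})"
proof (intro equalityI subsetI)
  fix c assume c: "c \<in> brel `` {bar b}"
  then have "(b, bar c) \<in> brel" using brel_rev[of "bar b" c] scaf.arev_arev[OF b] by simp
  moreover have "c = bar (bar c)" using c brel_B[of "bar b" c] scaf.arev_arev by simp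
  ultimately show "c \<in> bar ` (brel `` {b})" by blast
qed (auto intro: brel_rev)

lemma arev_bass_serre:
  assumes b: "b \<in> B"
  shows "arev (bass_serre_tree \<G> E A) (anode A b) = anode A (bar b)"
proof -
  have "acoord A ` (brel `` {bar b}) = acoord A ` (brel `` {b})"
    unfolding bar_class[OF b] image_image using brel_B by (intro image_cong) (auto simp: acoord_bar)
  then show ?thesis
    by (simp add: bass_serre_tree_def Let_def anode_def aover_rev[OF b])
qed

text \<open>These preimage maps invert \<open>x \<mapsto> vnode x\<close> and \<open>b \<mapsto> anode A b\<close> on classes.\<close>

definition vtree :: "'v \<times> ('v, 'a, 'g) letter list set set \<Rightarrow> 's set" where
  "vtree = (\<lambda>(v, C). {x \<in> V. over x = v \<and> coord x \<in> C})"

definition atree :: "'a \<times> ('v, 'a, 'g) letter list set set \<Rightarrow> 'b set" where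
  "atree = (\<lambda>(a, D). {b \<in> B. aover b = a \<and> acoord A b \<in> D})"

text \<open>The coordinate together with the projection pins down one end of the arc, and lifts of a
  base arc are unique at either end.\<close>

lemma acoord_inject:
  assumes b: "b \<in> B" and c: "c \<in> B" and "acoord A b = acoord A c" "aover b = aover c"
  shows "b = c"
proof (cases "aover b \<in> A")
  case True
  then have "src b = src c"
    using assms over_src[OF b] over_src[OF c]
    by (intro coord_inject) (auto simp: acoord_def scaf.tail_closed)
  then show ?thesis using arc_out_unique assms by blast
next
  case False
  then have "dst b = dst c"
    using assms over_dst[OF b] over_dst[OF c]
    by (intro coord_inject) (auto simp: acoord_def scaf.head_closed)
  then show ?thesis using arc_in_unique assms by blast
qed

lemma vtree_vnode:
  assumes x: "x \<in> V" shows "vtree (vnode x) = srel S `` {x}"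
proof (intro equalityI subsetI)
  fix y assume "y \<in> vtree (vnode x)"
  then obtain z where z: "y \<in> V" "over y = over x" "(x, z) \<in> srel S" "coord y = coord z"
    by (auto simp: vtree_def vnode_def)
  then have "y = z" using srel_V[OF z(3)] over_cong[OF z(3)] by (intro coord_inject) auto
  then show "y \<in> srel S `` {x}" using z by simp
next
  fix y assume "y \<in> srel S `` {x}"
  then show "y \<in> vtree (vnode x)"
    using srel_V[of x y] over_cong[of x y] by (auto simp: vtree_def vnode_def)
qed

lemma atree_anode:
  assumes b: "b \<in> B" shows "atree (anode A b) = brel `` {b}"
proof (intro equalityI subsetI)
  fix c assume "c \<in> atree (anode A b)"
  then obtain d where d: "c \<in> B" "aover c = aover b" "(b, d) \<in> brel" "acoord A c = acoord A d"
    by (auto simp: atree_def anode_def)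
  then have "c = d" using brel_B[OF d(3)] aover_cong[OF d(3)] by (intro acoord_inject) auto
  then show "c \<in> brel `` {b}" using d by simp
next
  fix c assume "c \<in> brel `` {b}"
  then show "c \<in> atree (anode A b)"
    using brel_B[of b c] aover_cong[of b c] by (auto simp: atree_def anode_def)
qed

lemma vnode_cong: "srel S `` {x} = srel S `` {y} \<Longrightarrow> vnode x = vnode y"
  by (simp add: vnode_def over_def)

lemma anode_cong: "brel `` {b} = brel `` {c} \<Longrightarrow> anode A b = anode A c"
  by (simp add: anode_def aover_def)

lemma tree_iso: "rgraph_iso (bass_serre_tree \<G> E A) (stree S) vtree atree"
proof -
  have "bij_betw vtree (vnode ` V) (V // srel S)"
    unfolding bij_betw_def
  proof
    show "inj_on vtree (vnode ` V)"
    proof (rule inj_onI)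
      fix X Y assume "X \<in> vnode ` V" "Y \<in> vnode ` V" and eq: "vtree X = vtree Y"
      then obtain x y where xy: "x \<in> V" "X = vnode x" "y \<in> V" "Y = vnode y" by blast
      then have "srel S `` {x} = srel S `` {y}" using eq by (simp add: vtree_vnode)
      then show "X = Y" unfolding xy(2,4) by (rule vnode_cong)
    qed
    show "vtree ` vnode ` V = V // srel S"
      unfolding image_image quotient_def by (auto simp: vtree_vnode)
  qed
  moreover have "bij_betw atree (anode A ` B) (B // brel)"
    unfolding bij_betw_def
  proof
    show "inj_on atree (anode A ` B)"
    proof (rule inj_onI)
      fix X Y assume "X \<in> anode A ` B" "Y \<in> anode A ` B" and eq: "atree X = atree Y"
      then obtain x y where xy: "x \<in> B" "X = anode A x" "y \<in> B" "Y = anode A y" by blast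
      then have "brel `` {x} = brel `` {y}" using eq by (simp add: atree_anode)
      then show "X = Y" unfolding xy(2,4) by (rule anode_cong)
    qed
    show "atree ` anode A ` B = B // brel"
      unfolding image_image quotient_def by (auto simp: atree_anode)
  qed
  moreover have "rgraph_hom (bass_serre_tree \<G> E A) (stree S) vtree atree"
    unfolding rgraph_hom_def verts_bass_serre arcs_bass_serre
    by (auto simp: vtree_vnode atree_anode class_in_stree arc_class_in_stree tail_bass_serre
        head_bass_serre arev_bass_serre tail_stree head_stree arev_stree
        scaf.tail_closed scaf.head_closed scaf.arev_in_arcs)
  ultimately show ?thesis
    unfolding rgraph_iso_def verts_bass_serre arcs_bass_serre verts_stree arcs_stree by blast
qed

lemma vmap_class:
  assumes p: "p \<in> carrier P" and x: "x \<in> V"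
  shows "vmap p ` (srel S `` {x}) = srel S `` {vmap p x}"
proof (intro equalityI subsetI)
  fix y assume y: "y \<in> srel S `` {vmap p x}"
  then have yV: "y \<in> V" using srel_V[of "vmap p x" y] by simp
  have i: "inv\<^bsub>P\<^esub> p \<in> carrier P" using p by simp
  have "(vmap (inv\<^bsub>P\<^esub> p) (vmap p x), vmap (inv\<^bsub>P\<^esub> p) y) \<in> srel S"
    using y by (intro vmap_related(1)[OF i]) simp
  then show "y \<in> vmap p ` (srel S `` {x})"
    using vmap_inv[OF p x] vmap_inv[OF p yV] by (intro image_eqI[of _ _ "vmap (inv\<^bsub>P\<^esub> p) y"]) simp_all
qed (use vmap_related(1)[OF p] in auto)

lemma amap_brel:
  assumes p: "p \<in> carrier P" and bc: "(b, c) \<in> brel"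
  shows "(amap p b, amap p c) \<in> brel"
  using brel_B[OF bc] bc p by (auto simp: arc_rel_def amap dst_amap vmap_related(1))

lemma amap_class:
  assumes p: "p \<in> carrier P" and b: "b \<in> B"
  shows "amap p ` (brel `` {b}) = brel `` {amap p b}"
proof (intro equalityI subsetI)
  fix c assume c: "c \<in> brel `` {amap p b}"
  then have cB: "c \<in> B" using brel_B[of "amap p b" c] by simp
  have i: "inv\<^bsub>P\<^esub> p \<in> carrier P" using p by simp
  have "(amap (inv\<^bsub>P\<^esub> p) (amap p b), amap (inv\<^bsub>P\<^esub> p) c) \<in> brel"
    using c by (intro amap_brel[OF i]) simp
  then show "c \<in> amap p ` (brel `` {b})"
    using amap_inv[OF p b] amap_inv[OF p cB] by (intro image_eqI[of _ _ "amap (inv\<^bsub>P\<^esub> p) c"]) simp_all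
qed (use amap_brel[OF p] in auto)

lemma acoord_amap:
  assumes p: "p \<in> carrier P" and b: "b \<in> B"
  shows "acoord A (amap p b) = p \<otimes>\<^bsub>P\<^esub> acoord A b"
  using amap[OF p b] dst_amap[OF p b] vmap(2)[OF p] scaf.tail_closed[OF b] scaf.head_closed[OF b]
  by (simp add: acoord_def)

lemma on_verts_vnode:
  assumes p: "p \<in> carrier P" and x: "x \<in> V"
  shows "on_verts (bass_serre_action \<G> E A) p (vnode x) = vnode (vmap p x)"
proof -
  have "p <#\<^bsub>P\<^esub> (coord ` (srel S `` {x})) = (\<lambda>y. coord (vmap p y)) ` (srel S `` {x})"
    using srel_V vmap(2)[OF p] by (fastforce simp: l_coset_def)
  then show ?thesis
    using vmap(3)[OF p x]
    by (simp add: bass_serre_action_def vnode_def vmap_class[OF p x, symmetric] image_image)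
qed

lemma on_arcs_anode:
  assumes p: "p \<in> carrier P" and b: "b \<in> B"
  shows "on_arcs (bass_serre_action \<G> E A) p (anode A b) = anode A (amap p b)"
proof -
  have "p <#\<^bsub>P\<^esub> (acoord A ` (brel `` {b})) = (\<lambda>c. acoord A (amap p c)) ` (brel `` {b})"
    using brel_B acoord_amap[OF p] by (fastforce simp: l_coset_def)
  then show ?thesis
    using amap(3)[OF p b]
    by (simp add: bass_serre_action_def anode_def amap_class[OF p b, symmetric] image_image)
qed

text \<open>Both actions are induced by \<open>vmap p\<close> and \<open>amap p\<close> on the
  scaffolding, so equivariance is checked on the nodes \<open>vnode x\<close> and
  \<open>anode A b\<close>, which exhaust the Bass--Serre tree.\<close>

lemma actions_isomorphic:
  "isomorphic_actions (bass_serre_action \<G> E A) (universal_action (regular_actions \<G>) S)"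
proof -
  let ?Q = "universal_action (regular_actions \<G>) S"
  have "on_verts ?Q (iso_map p) (vtree (vnode x)) = vtree (on_verts (bass_serre_action \<G> E A) p (vnode x))"
    if "p \<in> carrier P" "x \<in> V" for p x
    using that
    by (simp add: on_verts_vnode vtree_vnode vmap(1) vmap_class universal_action_def iso_map_def)
  moreover have "on_arcs ?Q (iso_map p) (atree (anode A b)) = atree (on_arcs (bass_serre_action \<G> E A) p (anode A b))"
    if "p \<in> carrier P" "b \<in> B" for p b
    using that
    by (simp add: on_arcs_anode atree_anode amap(1) amap_class universal_action_def iso_map_def)
  moreover have "agroup (bass_serre_action \<G> E A) = P" "agraph (bass_serre_action \<G> E A) = bass_serre_tree \<G> E A"
    "agroup ?Q = U" "agraph ?Q = stree S"
    by (simp_all add: bass_serre_action_def universal_action_def)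
  ultimately show ?thesis
    unfolding isomorphic_actions_def
    using iso_map_iso tree_iso
    by (intro exI[of _ iso_map] exI[of _ vtree] exI[of _ atree])
      (auto simp: verts_bass_serre arcs_bass_serre)
qed

end

end

theorem theorem8p2:
  fixes \<G> :: "('v, 'a, 'g, 'h) gog" and E A :: "'a set"
    and S :: "('v, 'a, 'g, 'h, 's, 'b) scaffold"
  assumes "graph_of_groups \<G>"
    and "spanning_tree_arcs (base \<G>) E" and "orientation (base \<G>) A"
    and "scaffolding (regular_actions \<G>) S"
  shows "isomorphic_actions (bass_serre_action \<G> E A) (universal_action (regular_actions \<G>) S) \<and>
    fundamental_group \<G> E \<cong> universal_group (regular_actions \<G>) S"
proof -
  interpret regular_scaffolding \<G> E S
    using assms
    by (intro regular_scaffolding.intro presented_group.intro presented_group_axioms.intro)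
  show ?thesis
    using actions_isomorphic[OF assms(3)] iso_map_iso by (auto simp: is_iso_def)
qed

end
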